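(* For any dimension $d\geq 2$ there exist moduli of continuity $\omega_{1},\omega_{2},\omega_{3}$ such that whenever $i,j\in\{1,2,3\}$ with $i<j$, the set of $\omega_{j}$-regular separated nets of $\mathbb{R}^{d}$ is strictly contained in the set of $\omega_{i}$-regular separated nets of $\mathbb{R}^d$.
   Context: A set $Z\subseteq\mathbb{R}^d$ is separated if $\inf\{\|z-z'\|_2: z,z'\in Z,\ z\ne z'\}>0$, and a net of $\mathbb{R}^d$ if $\sup_{x\in\mathbb{R}^d}\inf_{z\in Z}\|z-x\|_2<\infty$; a separated net is a set that is both. A modulus of continuity is a strictly increasing, concave function $\omega$ defined on a positive open interval starting at $0$ with $\lim_{t\to0}\omega(t)=0$. For separated nets $X,Y\subseteq\mathbb{R}^d$, a mapping $f\colon X\to Y$ is a homogeneous $\omega$-mapping if there are constants $K>1$ and $a>0$ such that $$\|f(y)-f(x)\|_2\le K R\,\omega\!\left(\frac{\|y-x\|_2}{R}\right)$$ for all $R>0$ and all $x,y\in X\cap\overline{B}(\mathbf{0},R)$ with $\|y-x\|_2<aR$ (with $a$ small enough that $\omega$ is defined on $(0,a)$; the case $x=y$ is trivial, reading $\omega(0)=0$). A separated net $X\subseteq\mathbb{R}^d$ is $\omega$-regular if there is a bijection $f\colon X\to\mathbb{Z}^d$ such that both $f$ and $f^{-1}$ are homogeneous $\omega$-mappings. *)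

theory Defs
  imports "HOL-Analysis.Analysis"
begin

text \<open>Infima and suprema of distances are taken in \<^typ>\<open>ereal\<close>, so that the infimum over the
  empty set is \<open>\<infinity>\<close>: a set with at most one point is separated, and the empty set is not a net.\<close>

definition separated :: "(real ^ 'n) set \<Rightarrow> bool" where
  "separated Z \<longleftrightarrow> Inf {ereal (norm (z - z')) | z z'. z \<in> Z \<and> z' \<in> Z \<and> z \<noteq> z'} > 0"

definition net :: "(real ^ 'n) set \<Rightarrow> bool" where
  "net Z \<longleftrightarrow> (SUP x. INF z\<in>Z. ereal (norm (z - x))) < \<infinity>"

definition separated_net :: "(real ^ 'n) set \<Rightarrow> bool" where
  "separated_net Z \<longleftrightarrow> separated Z \<and> net Z"

definition integer_lattice :: "(real ^ 'n) set" where
  "integer_lattice = {z. \<forall>i. z $ i \<in> \<int>}"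

text \<open>The set \<open>I\<close> is the domain of the modulus, an interval \<open>(0, b)\<close> with \<open>b\<close> positive and possibly
  infinite; the values of \<open>\<omega>\<close> outside \<open>I\<close> are irrelevant.\<close>

definition modulus_of_continuity :: "real set \<Rightarrow> (real \<Rightarrow> real) \<Rightarrow> bool" where
  "modulus_of_continuity I \<omega> \<longleftrightarrow>
     (I = {0<..} \<or> (\<exists>b>0. I = {0<..<b})) \<and>
     strict_mono_on I \<omega> \<and> concave_on I \<omega> \<and> (\<omega> \<longlongrightarrow> 0) (at_right 0)"

text \<open>The condition \<open>x \<noteq> y\<close> renders the convention \<open>\<omega>(0) = 0\<close>; the condition \<open>{0<..<a} \<subseteq> I\<close>
  ensures that \<open>\<omega>\<close> is evaluated only inside its domain.\<close>

definition homogeneous_mapping ::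
  "real set \<Rightarrow> (real \<Rightarrow> real) \<Rightarrow> (real ^ 'n) set \<Rightarrow> (real ^ 'n) set \<Rightarrow> (real ^ 'n \<Rightarrow> real ^ 'n) \<Rightarrow> bool"
where
  "homogeneous_mapping I \<omega> X Y f \<longleftrightarrow>
     f \<in> X \<rightarrow> Y \<and>
     (\<exists>K>1. \<exists>a>0. {0<..<a} \<subseteq> I \<and>
        (\<forall>R>0. \<forall>x \<in> X \<inter> cball 0 R. \<forall>y \<in> X \<inter> cball 0 R.
           x \<noteq> y \<and> norm (y - x) < a * R \<longrightarrow>
           norm (f y - f x) \<le> K * R * \<omega> (norm (y - x) / R)))"

definition regular_separated_net :: "real set \<Rightarrow> (real \<Rightarrow> real) \<Rightarrow> (real ^ 'n) set \<Rightarrow> bool" where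
  "regular_separated_net I \<omega> X \<longleftrightarrow>
     separated_net X \<and>
     (\<exists>f. bij_betw f X integer_lattice \<and>
        homogeneous_mapping I \<omega> X integer_lattice f \<and>
        homogeneous_mapping I \<omega> integer_lattice X (inv_into X f))"

end

theory Submission
  imports Defs
begin

text \<open>
  The largest modulus is the square root, the smallest is the identity, and a third one in between is
  determined by a separated net that distinguishes it from the square root.

  All nets used for the separation are integer lattices with sparse patches: the lattice is
  modified only in cubes of sides \<open>n k\<close> at distances \<open>\<rho> k\<close> from the origin, where the \<open>\<rho> k\<close> are
  very large. A homogeneous \<open>\<omega>\<close>-mapping may move points at distance \<open>R\<close> from the origin by about
  \<open>R * \<omega> (1 / R)\<close>, which tends to infinity with \<open>R\<close> unless \<open>\<omega>\<close> is essentially linear. So if \<open>\<rho> k\<close> is large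
  compared with \<open>n k\<close>, any rearrangement inside the patches is harmless and the net is \<open>\<omega>\<close>-regular
  (\<open>regular_range_emb\<close>). Conversely, once the positions are fixed, a modulus growing sufficiently
  slowly above the identity forces a homogeneous mapping to be bilipschitz on the \<open>k\<close>-th patch with
  constant \<open>(k + 1)\<^sup>2\<close>, for all large \<open>k\<close>. If the \<open>k\<close>-th patch admits no such map, then the net is not regular for
  the slower modulus (\<open>irregular_range_emb\<close>). The infimum of the affine functions \<open>(k + 1) * t + 1 / \<rho> k\<close>
  is a modulus of this kind which is still not linear, so the construction can be repeated with it in
  place of the square root (\<open>separating_net\<close>); this second net separates it from the identity.

  It remains to find, for every \<open>L\<close>, a patch that does not admit an \<open>L\<close>-bilipschitz bijection to
  the integer lattice (\<open>irregular_patch_exists\<close>). This is a finite version of the construction of Burago and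
  Kleiner. In thin strips parallel to one axis the points are arranged in cells of alternating
  density. Consider a segment inside a strip whose ends are stretched by the factor \<open>A\<close>. If no
  shorter pair across neighbouring cells is stretched by noticeably more than \<open>A\<close>, then all these pairs are
  mapped to almost the same vector, hence the image of a dense cell is almost a translate of the
  image of the following sparse cell, which contradicts the number of their points
  (\<open>no_translated_cell\<close>). So there is a shorter pair that is stretched more (\<open>stretch_step\<close>).
  Inside the cells there are thinner strips with the same properties at a smaller scale, which are so thin that
  they do not affect the count. Iterating, the stretch finally exceeds \<open>L\<close>.
\<close>

section \<open>Squeezing and spreading the integers periodically\<close>

text \<open>A piecewise linear homeomorphism of the line that preserves each interval of length \<open>2 * w\<close>
  starting at a multiple of \<open>2 * w\<close>: the first three quarters of the interval are squeezed onto its first half,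
  the last quarter is spread over its second half. Hence the image of the integers has gap \<open>2/3\<close> and gap
  \<open>2\<close> in alternating intervals of length \<open>w\<close>, a contrast of densities of \<open>3\<close>. The maximum of the two
  linear branches makes the bounds on the gaps immediate.\<close>
definition warp :: "int \<Rightarrow> int \<Rightarrow> real" where
  "warp w s = real_of_int (2 * w * (s div (2 * w)))
     + max (2 / 3 * real_of_int (s mod (2 * w))) (2 * real_of_int (s mod (2 * w)) - 2 * real_of_int w)"

text \<open>The right end \<open>t = 2 * w\<close> is included, where the formula agrees with the one of the following
  period; so two consecutive integers are always covered by the same instance.\<close>
lemma warp_add:
  assumes "w > 0" "2 * w dvd a" "0 \<le> t" "t \<le> 2 * w"
  shows "warp w (a + t) = real_of_int a + max (2 / 3 * real_of_int t) (2 * real_of_int t - 2 * real_of_int w)"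
proof -
  obtain c where a: "a = 2 * w * c" using assms(2) by (auto elim: dvdE)
  show ?thesis
  proof (cases "t = 2 * w")
    case True
    then have at: "a + t = 2 * w * (c + 1)" using a by (simp add: algebra_simps)
    have "(a + t) div (2 * w) = c + 1" "(a + t) mod (2 * w) = 0"
      unfolding at using assms(1) by simp_all
    then show ?thesis using assms(1) True a by (simp add: warp_def algebra_simps)
  next
    case False
    then have t: "t < 2 * w" using assms(4) by simp
    have "(a + t) div (2 * w) = c" "(a + t) mod (2 * w) = t"
      unfolding a using assms(1,3) t by (simp_all add: div_pos_pos_trivial mod_pos_pos_trivial)
    then show ?thesis using a by (simp add: warp_def)
  qed
qed

lemma warp_fixed: "w > 0 \<Longrightarrow> 2 * w dvd a \<Longrightarrow> warp w a = real_of_int a"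
  using warp_add[of w a 0] by simp

lemma warp_step:
  assumes "w > 0"
  shows "2 / 3 \<le> warp w (s + 1) - warp w s" "warp w (s + 1) - warp w s \<le> 2"
proof -
  define a where "a = 2 * w * (s div (2 * w))"
  define t where "t = s mod (2 * w)"
  have s: "s = a + t" by (simp add: a_def t_def)
  have t: "0 \<le> t" "t < 2 * w" using assms by (auto simp: t_def)
  have "warp w s = real_of_int a + max (2 / 3 * real_of_int t) (2 * real_of_int t - 2 * real_of_int w)"
    unfolding s using assms t by (intro warp_add) (auto simp: a_def)
  moreover have "warp w (a + (t + 1))
     = real_of_int a + max (2 / 3 * real_of_int (t + 1)) (2 * real_of_int (t + 1) - 2 * real_of_int w)"
    using assms t by (intro warp_add) (auto simp: a_def)
  moreover have "a + (t + 1) = s + 1" using s by simp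
  ultimately have "warp w (s + 1) - warp w s
      = max (2 / 3 * real_of_int t + 2 / 3) (2 * real_of_int t - 2 * real_of_int w + 2)
        - max (2 / 3 * real_of_int t) (2 * real_of_int t - 2 * real_of_int w)"
    by (simp add: add_divide_distrib algebra_simps)
  then show "2 / 3 \<le> warp w (s + 1) - warp w s" "warp w (s + 1) - warp w s \<le> 2"
    by linarith+
qed

text \<open>Since periods are preserved, the position relative to a period boundary does not change.\<close>
lemma warp_ge_iff:
  assumes "w > 0" "2 * w dvd a"
  shows "real_of_int a \<le> warp w s \<longleftrightarrow> a \<le> s"
proof -
  define b where "b = s div (2 * w)"
  define t where "t = s mod (2 * w)"
  have s: "s = 2 * w * b + t" by (simp add: b_def t_def)
  have t: "0 \<le> t" "t < 2 * w" using assms by (auto simp: t_def)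
  obtain c where a: "a = 2 * w * c" using assms(2) by (auto elim: dvdE)
  have w: "warp w s = real_of_int (2 * w * b) + max (2 / 3 * real_of_int t) (2 * real_of_int t - 2 * real_of_int w)"
    unfolding s using assms(1) t by (intro warp_add) auto
  show ?thesis
  proof (cases "c \<le> b")
    case True
    then have "2 * w * c \<le> 2 * w * b" using assms(1) by simp
    then have "real_of_int a \<le> real_of_int (2 * w * b)" "a \<le> s"
      using a s t by (simp_all only: of_int_le_iff)
    then show ?thesis using w t by (auto simp: max_def)
  next
    case False
    then have "2 * w * (b + 1) \<le> 2 * w * c" using assms(1) by simp
    then have *: "2 * w * b + 2 * w \<le> a" using a by (simp add: algebra_simps)
    then have "real_of_int (2 * w * b) + 2 * real_of_int w \<le> real_of_int a"
      by (metis of_int_add of_int_le_iff of_int_mult of_int_numeral)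
    moreover have "max (2 / 3 * real_of_int t) (2 * real_of_int t - 2 * real_of_int w) < 2 * real_of_int w"
      using t assms(1) by (auto simp: max_def)
    ultimately have "\<not> real_of_int a \<le> warp w s" using w by linarith
    moreover have "\<not> a \<le> s" using * s t by linarith
    ultimately show ?thesis by simp
  qed
qed

section \<open>Auxiliary estimates\<close>
lemma divide_le_divide_cross:
  fixes a b c d :: real
  assumes "b > 0" "d > 0" "a * d \<le> c * b"
  shows "a / b \<le> c / d"
  using assms by (simp add: field_simps)

text \<open>Vectors of norm at most \<open>Z\<close> whose sum almost attains the largest possible component along a unit
  vector \<open>u\<close> must on average be close to \<open>Z *\<^sub>R u\<close>: the deficits \<open>Z - D q i \<bullet> u\<close> are nonnegative and
  have a small sum. Averaging over the positions \<open>i\<close> yields a position that is good for all the chains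
  \<open>q\<close> at once. The position is required to be even since in the application the even positions are
  those that lead from a dense cell to a sparse one.\<close>
lemma almost_parallel:
  fixes D :: "'q \<Rightarrow> nat \<Rightarrow> 'v::real_inner"
  assumes Q: "finite Q" and m: "m > 0" and u: "norm u = 1" and Z: "Z \<ge> 0"
    and D: "\<And>q i. q \<in> Q \<Longrightarrow> i < 2 * m - 1 \<Longrightarrow> norm (D q i) \<le> Z"
    and S: "\<And>q. q \<in> Q \<Longrightarrow> (\<Sum>i<2 * m - 1. D q i \<bullet> u) \<ge> real (2 * m - 1) * Z - c"
  obtains j where "j < m"
    and "\<And>q. q \<in> Q \<Longrightarrow> (norm (D q (2 * j) - Z *\<^sub>R u))\<^sup>2 \<le> 2 * Z * (real (card Q) * c / real m)"
proof -
  define e where "e q i = Z - D q i \<bullet> u" for q i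
  have e0: "e q i \<ge> 0" if "q \<in> Q" "i < 2 * m - 1" for q i
    using D[OF that] Cauchy_Schwarz_ineq2[of "D q i" u] u by (auto simp: e_def)
  have "(\<Sum>j<m. e q (2 * j)) \<le> c" if q: "q \<in> Q" for q
  proof -
    have "(\<Sum>j<m. e q (2 * j)) = sum (e q) ((\<lambda>j. 2 * j) ` {..<m})"
      by (subst sum.reindex) (auto simp: inj_on_def)
    also have "\<dots> \<le> sum (e q) {..<2 * m - 1}"
      using e0[OF q] by (intro sum_mono2) auto
    also have "\<dots> \<le> c"
      using S[OF q] by (simp add: e_def sum_subtractf)
    finally show ?thesis .
  qed
  then have tot: "(\<Sum>j<m. \<Sum>q\<in>Q. e q (2 * j)) \<le> real (card Q) * c"
    by (subst sum.swap) (intro sum_bounded_above, auto)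
  have "\<exists>j<m. (\<Sum>q\<in>Q. e q (2 * j)) \<le> real (card Q) * c / real m"
  proof (rule ccontr)
    assume "\<not> ?thesis"
    then have "(\<Sum>j<m. real (card Q) * c / real m) < (\<Sum>j<m. \<Sum>q\<in>Q. e q (2 * j))"
      using m by (intro sum_strict_mono) (auto simp: not_le lessThan_empty_iff)
    then show False using tot m by simp
  qed
  then obtain j where j: "j < m" "(\<Sum>q\<in>Q. e q (2 * j)) \<le> real (card Q) * c / real m" by blast
  show ?thesis
  proof (rule that[OF j(1)])
    fix q assume q: "q \<in> Q"
    have j2: "2 * j < 2 * m - 1" using j(1) by auto
    have "e q (2 * j) \<le> (\<Sum>q\<in>Q. e q (2 * j))"
      using Q q e0 j2 by (intro member_le_sum) auto
    then have le: "e q (2 * j) \<le> real (card Q) * c / real m" using j(2) by linarith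
    have "(norm (D q (2 * j) - Z *\<^sub>R u))\<^sup>2 = (norm (D q (2 * j)))\<^sup>2 - 2 * Z * (D q (2 * j) \<bullet> u) + Z\<^sup>2"
      using u unfolding power2_norm_eq_inner norm_eq_1
      by (simp add: inner_diff inner_commute algebra_simps power2_eq_square)
    also have "\<dots> \<le> Z\<^sup>2 - 2 * Z * (D q (2 * j) \<bullet> u) + Z\<^sup>2"
      using D[OF q j2] by (simp add: power_mono)
    also have "\<dots> = 2 * Z * e q (2 * j)" by (simp add: e_def algebra_simps power2_eq_square)
    also have "\<dots> \<le> 2 * Z * (real (card Q) * c / real m)"
      using le Z by (intro mult_left_mono) auto
    finally show "(norm (D q (2 * j) - Z *\<^sub>R u))\<^sup>2 \<le> 2 * Z * (real (card Q) * c / real m)" .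
  qed
qed

lemma norm_triangle3:
  fixes a b c :: "'v::real_normed_vector"
  shows "norm (a - b + c) \<le> norm a + norm b + norm c"
  using norm_triangle_ineq[of "a - b" c] norm_triangle_ineq4[of a b] by linarith
lemma norm_le_card_mult:
  fixes x :: "real ^ 'n::finite"
  assumes "\<And>i. \<bar>x $ i\<bar> \<le> c"
  shows "norm x \<le> real CARD('n) * c"
proof -
  have "norm x \<le> (\<Sum>i\<in>UNIV. \<bar>x $ i\<bar>)" by (rule norm_le_l1_cart)
  also have "\<dots> \<le> real CARD('n) * c" using assms by (intro sum_bounded_above) auto
  finally show ?thesis .
qed

lemma card_product_of_sets:
  fixes i0 :: "'n::finite" and S :: "'n \<Rightarrow> int set"
  assumes "\<And>i. finite (S i)"
  shows "finite {z. \<forall>i. z i \<in> S i}"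
    and "card {z. \<forall>i. z i \<in> S i} = card (S i0) * (\<Prod>i\<in>UNIV - {i0}. card (S i))"
proof -
  have eq: "{z. \<forall>i. z i \<in> S i} = Pi\<^sub>E UNIV S" by (auto simp: PiE_def Pi_def)
  show "finite {z. \<forall>i. z i \<in> S i}" unfolding eq using assms by (intro finite_PiE) auto
  have "card {z. \<forall>i. z i \<in> S i} = (\<Prod>i\<in>UNIV. card (S i))"
    unfolding eq by (subst card_PiE) auto
  also have "\<dots> = card (S i0) * (\<Prod>i\<in>UNIV - {i0}. card (S i))"
    by (subst prod.remove[of _ i0]) auto
  finally show "card {z. \<forall>i. z i \<in> S i} = card (S i0) * (\<Prod>i\<in>UNIV - {i0}. card (S i))" .
qed

lemma card_box:
  fixes i0 :: "'n::finite" and S :: "'n \<Rightarrow> int set"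
  assumes fin: "\<And>i. finite (S i)" and card: "\<And>i. i \<noteq> i0 \<Longrightarrow> card (S i) = c"
  shows "finite {z. \<forall>i. z i \<in> S i}"
    and "card {z. \<forall>i. z i \<in> S i} = card (S i0) * c ^ (CARD('n) - 1)"
proof -
  have "(\<Prod>i\<in>UNIV - {i0}. card (S i)) = (\<Prod>i\<in>UNIV - {i0}. c)"
    using card by (intro prod.cong) auto
  then show "finite {z. \<forall>i. z i \<in> S i}" "card {z. \<forall>i. z i \<in> S i} = card (S i0) * c ^ (CARD('n) - 1)"
    using card_product_of_sets(1)[of S, OF fin] card_product_of_sets(2)[of S i0, OF fin] by simp_all
qed

lemma card_box_le:
  fixes i0 :: "'n::finite" and S :: "'n \<Rightarrow> int set"
  assumes fin: "\<And>i. finite (S i)" and card: "\<And>i. i \<noteq> i0 \<Longrightarrow> card (S i) \<le> c"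
  shows "finite {z. \<forall>i. z i \<in> S i}"
    and "card {z. \<forall>i. z i \<in> S i} \<le> card (S i0) * c ^ (CARD('n) - 1)"
proof -
  have "(\<Prod>i\<in>UNIV - {i0}. card (S i)) \<le> (\<Prod>i\<in>UNIV - {i0}. c)"
    using card by (intro prod_mono) auto
  then show "finite {z. \<forall>i. z i \<in> S i}" "card {z. \<forall>i. z i \<in> S i} \<le> card (S i0) * c ^ (CARD('n) - 1)"
    using card_product_of_sets(1)[of S, OF fin] card_product_of_sets(2)[of S i0, OF fin] by simp_all
qed
lemma card_residues_less:
  assumes "g > 0" "E \<ge> 0" "h \<ge> 0" "g dvd a"
  shows "card {x\<in>{a..<a + E * g}. x mod g < h} \<le> nat (E * h)"
proof -
  let ?S = "{x\<in>{a..<a + E * g}. x mod g < h}"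
  obtain c where a: "a = g * c" using assms(4) by (auto elim: dvdE)
  have "(\<lambda>x. (x div g, x mod g)) ` ?S \<subseteq> {c..<c + E} \<times> {0..<h}"
  proof clarsimp
    fix x assume x: "a \<le> x" "x < a + E * g"
    have "c \<le> x div g" using x(1) a assms(1)
      by (metis div_pos_pos_trivial nonzero_mult_div_cancel_left order_less_irrefl zdiv_mono1)
    moreover have "x < (c + E) * g" using x(2) a by (simp add: algebra_simps)
    then have "(x div g) * g < (c + E) * g"
      using pos_mod_sign[OF assms(1), of x] div_mult_mod_eq[of x g] by linarith
    then have "x div g < c + E" using assms(1) by simp
    ultimately show "c \<le> x div g \<and> x div g < c + E \<and> 0 \<le> x mod g"
      using assms(1) by simp
  qed
  moreover have "inj_on (\<lambda>x. (x div g, x mod g)) ?S"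
    by (intro inj_onI) (metis div_mult_mod_eq prod.inject)
  ultimately have "card ?S \<le> card ({c..<c + E} \<times> {0..<h})"
    by (intro card_inj_on_le) auto
  then show ?thesis using assms by (simp add: card_cartesian_product nat_mult_distrib)
qed

section \<open>A hierarchy of strips\<close>
definition lattice_point :: "('n \<Rightarrow> int) \<Rightarrow> real ^ 'n::finite" where
  "lattice_point z = (\<chi> i. real_of_int (z i))"

lemma lattice_point_nth [simp]: "lattice_point z $ i = real_of_int (z i)"
  by (simp add: lattice_point_def)

lemma range_lattice_point: "range lattice_point = integer_lattice"
proof (intro equalityI subsetI)
  fix x :: "real ^ 'n" assume "x \<in> integer_lattice"
  then have "x = lattice_point (\<lambda>i. \<lfloor>x $ i\<rfloor>)"
    by (auto simp: vec_eq_iff integer_lattice_def elim: Ints_cases)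
  then show "x \<in> range lattice_point" by blast
qed (auto simp: integer_lattice_def)

definition patch_map :: "'n \<Rightarrow> (('n \<Rightarrow> int) \<Rightarrow> int) \<Rightarrow> ('n \<Rightarrow> int) \<Rightarrow> real ^ 'n::finite" where
  "patch_map i0 W z = (\<chi> i. if i = i0 then warp (W z) (z i0) else real_of_int (z i))"

definition int_box :: "int \<Rightarrow> ('n \<Rightarrow> int) set" where
  "int_box n = {z. \<forall>i. 0 \<le> z i \<and> z i < n}"

text \<open>Widths of warps grow geometrically with the level \<open>l\<close>, by the factor \<open>E * B\<close>. The strips of level
  \<open>l\<close> are the tubes parallel to the axis \<open>i0\<close> whose cross-sections are cubes of side \<open>u l\<close> placed at
  the points of the grid of mesh \<open>B * u l\<close>; so they occupy the fraction \<open>(1 / B) ^ (d - 1)\<close> of the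
  space, which is small because the dimension \<open>d\<close> is at least \<open>2\<close>. On the other hand \<open>E\<close> grid
  points fit on each side of a cube of side \<open>u (Suc l)\<close>, so for large \<open>E\<close> the strips of level \<open>l\<close>
  come close to every point of such a cube.\<close>
locale strip_hierarchy =
  fixes i0 :: "'n::finite" and E B s :: int
  assumes E_pos: "E > 0" and B_pos: "B > 0" and B_even: "even B" and s_pos: "s > 0"
begin

definition u :: "nat \<Rightarrow> int" where "u l = s * (E * B) ^ l"

definition in_strip :: "nat \<Rightarrow> ('n \<Rightarrow> int) \<Rightarrow> bool" where
  "in_strip l z \<longleftrightarrow> (\<forall>i. i \<noteq> i0 \<longrightarrow> z i mod (B * u l) < u l)"

text \<open>Of the fibres, those inside the strips of all levels from \<open>l\<close> to the top, but outside those of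
  level \<open>l - 1\<close>, are warped with width \<open>u l\<close>. Finer patterns thus overrule coarser ones, but only on a
  small part of each coarser strip.\<close>
primrec width :: "nat \<Rightarrow> ('n \<Rightarrow> int) \<Rightarrow> int" where
  "width 0 z = u 0"
| "width (Suc l) z = (if in_strip l z then width l z else u (Suc l))"

lemma u_pos: "u l > 0"
  using E_pos B_pos s_pos by (simp add: u_def)

lemma u_Suc: "u (Suc l) = E * (B * u l)"
  by (simp add: u_def)

lemma u_dvd: "l \<le> l' \<Longrightarrow> u l dvd u l'"
  by (simp add: u_def le_imp_power_dvd)

lemma Bu_dvd_u: "l < l' \<Longrightarrow> B * u l dvd u l'"
  using u_dvd[of "Suc l" l'] by (metis Suc_leI dvd_trans dvd_triv_right u_Suc)

lemma Bu_dvd: "l \<le> l' \<Longrightarrow> B * u l dvd B * u l'"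
  by (simp add: u_dvd)

lemma two_u_dvd: "2 * u l dvd B * u l"
  using B_even by (simp add: mult_dvd_mono)

lemma width_pos: "width l z > 0"
  by (induction l) (simp_all add: u_pos)

lemma width_dvd: "width l z dvd u l"
  by (induction l) (auto intro: dvd_trans[OF _ u_dvd])

lemma in_strip_indep: "in_strip l (z(i0 := t)) = in_strip l z"
  by (simp add: in_strip_def)

lemma width_indep: "width l (z(i0 := t)) = width l z"
  by (induction l) (simp_all add: in_strip_indep del: fun_upd_apply)

lemma width_in_strips:
  "l \<le> J \<Longrightarrow> (\<And>l'. l \<le> l' \<Longrightarrow> l' < J \<Longrightarrow> in_strip l' z) \<Longrightarrow> width J z = width l z"
proof (induction J)
  case (Suc J)
  then show ?case by (cases "l = Suc J") (auto simp: le_Suc_eq)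
qed simp

lemma in_strip_grid: "(\<And>i. i \<noteq> i0 \<Longrightarrow> B * u l dvd z i) \<Longrightarrow> in_strip l z"
  by (simp add: in_strip_def u_pos)

text \<open>The boundaries of the strips of a higher level run through the grid of mesh \<open>B * u l\<close>. So the half-open
  cell at a grid point lies in such a strip as soon as its corner does.\<close>
lemma in_strip_near_grid:
  assumes p: "in_strip l' p" and l: "l < l'"
    and dvd: "\<And>i. i \<noteq> i0 \<Longrightarrow> B * u l dvd p i"
    and z: "\<And>i. i \<noteq> i0 \<Longrightarrow> p i \<le> z i \<and> z i < p i + B * u l"
  shows "in_strip l' z"
  unfolding in_strip_def
proof (intro allI impI)
  fix i assume i: "i \<noteq> i0"
  let ?P = "B * u l"
  have P: "?P > 0" using B_pos u_pos by simp
  obtain U where U: "u l' = ?P * U" using Bu_dvd_u[OF l] by (auto elim: dvdE)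
  obtain c where c: "p i = ?P * c" using dvd[OF i] by (auto elim: dvdE)
  define t where "t = z i - p i"
  have t: "0 \<le> t" "t < ?P" using z[OF i] by (auto simp: t_def)
  have zi: "z i = ?P * c + t" by (simp add: t_def c)
  have BU: "B * U > 0" using B_pos u_pos[of l'] U P by (simp add: zero_less_mult_iff)
  have mod: "(?P * c + r) mod (?P * (B * U)) = ?P * (c mod (B * U)) + r" if "0 \<le> r" "r < ?P" for r
  proof -
    have "(?P * c + r) div ?P = c" "(?P * c + r) mod ?P = r"
      using that by (intro int_div_pos_eq[of _ _ c r] int_mod_pos_eq[of _ _ c r]; simp)+
    then show ?thesis using BU by (simp only: zmod_zmult2_eq less_imp_le)
  qed
  have eq: "B * u l' = ?P * (B * U)" using U by simp
  have "p i mod (B * u l') < u l'" using p i by (auto simp: in_strip_def)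
  then have "?P * (c mod (B * U)) < ?P * U"
    using mod[of 0] P unfolding eq c U by simp
  then have "c mod (B * U) < U" using P mult_less_cancel_left_pos by blast
  then have "c mod (B * U) + 1 \<le> U" by simp
  then have "?P * (c mod (B * U) + 1) \<le> ?P * U" using P by (intro mult_left_mono) auto
  then have "?P * (c mod (B * U)) + t < ?P * U" using t by (simp add: algebra_simps)
  then show "z i mod (B * u l') < u l'"
    using mod[OF t] unfolding eq zi unfolding U by (simp only:)
qed

end

section \<open>A dense cell cannot be translated into a sparse one\<close>

text \<open>Here \<open>G\<close> parametrizes a set by the integer lattice such that the cube of side \<open>n\<close> at
  the origin carries the pattern of the hierarchy, and \<open>F\<close> is the composition of \<open>G\<close> with a bijection
  from this set to the integer lattice. This bijection is \<open>L\<close>-bilipschitz on the cube, and its inverse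
  does not separate nearby points from the image of the cube by more than the factor \<open>L\<close>. The aim is
  to bound the number \<open>J\<close> of levels. The constants \<open>E\<close>, \<open>B\<close> and \<open>s\<close> have to be large, with \<open>B\<close> depending
  on \<open>E\<close>: \<open>E\<close> makes the grid inside a cell fine, \<open>B\<close> makes finer strips thin and the segments
  formed by the cells long, and \<open>s\<close> makes rounding errors negligible.\<close>
locale bilipschitz_patch = strip_hierarchy i0 E B s
  for i0 :: "'n::finite" and E B s +
  fixes J :: nat and L d :: real and n :: int
    and G F :: "('n \<Rightarrow> int) \<Rightarrow> real ^ 'n"
  assumes n: "n = 2 * u J"
    and d: "d = real CARD('n)" and d2: "CARD('n) \<ge> 2" and L: "L \<ge> 1"
    and E_large: "real_of_int E \<ge> 24 * d\<^sup>2 * (L\<^sup>2 + 1)"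
    and B_large: "B \<ge> 10"
      "real_of_int B \<ge> 8 * L\<^sup>2 * (2 * d + 1) * real_of_int E ^ CARD('n) * (24 * d * L)\<^sup>2"
    and s_dvd: "16 * int CARD('n) dvd s" and s_large: "real_of_int s \<ge> 24 * d\<^sup>2 * L"
    and G: "\<And>z. z \<in> int_box n \<Longrightarrow> G z = patch_map i0 (width J) z"
    and G_box: "\<And>z. (\<And>i. 0 \<le> G z $ i \<and> G z $ i < real_of_int n) \<Longrightarrow> z \<in> int_box n"
    and F: "bij_betw F UNIV integer_lattice"
    and lip: "\<And>z z'. z \<in> int_box n \<Longrightarrow> z' \<in> int_box n \<Longrightarrow> norm (F z - F z') \<le> L * norm (G z - G z')"
    and colip: "\<And>z z'. z \<in> int_box n \<Longrightarrow> norm (F z - F z') \<le> L * d * real_of_int n \<Longrightarrow>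
       norm (G z - G z') \<le> L * norm (F z - F z')"
begin

lemma d_ge: "d \<ge> 2" using d d2 by simp

text \<open>A point of the grid of mesh \<open>B * u l\<close> lies in the strips of all lower levels. So the width of its
  fibre is the smallest one, and as \<open>B\<close> is even, the point is at the beginning of a period, where the warp
  is the identity.\<close>
lemma G_grid:
  assumes "l < J" "\<And>i. B * u l dvd q i" "\<And>l'. l < l' \<Longrightarrow> l' < J \<Longrightarrow> in_strip l' q" "q \<in> int_box n"
  shows "G q = lattice_point q"
proof -
  have "in_strip l' q" if "l' < J" for l'
  proof (cases "l < l'")
    case False
    then have "B * u l' dvd q i" for i using assms(2)[of i] Bu_dvd[of l' l] by (meson dvd_trans not_le less_or_eq_imp_le)
    then show ?thesis by (intro in_strip_grid)
  qed (use assms that in auto)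
  then have W: "width J q = u 0" using width_in_strips[of 0 J q] by simp
  have "2 * u 0 dvd q i0"
    using assms(2)[of i0] two_u_dvd[of 0] Bu_dvd[of 0 l] by (meson dvd_trans le0)
  then have "warp (u 0) (q i0) = real_of_int (q i0)" using u_pos by (intro warp_fixed) auto
  then show ?thesis using G[OF assms(4)] W by (simp add: patch_map_def vec_eq_iff)
qed

text \<open>Let \<open>b\<close> be the corner of a dense cell of side \<open>w\<close>, followed by a sparse cell in direction \<open>i0\<close>.
  If moving all grid points of the cell by \<open>w\<close> in this direction moves their images by almost the same
  vector \<open>V\<close>, then the same holds for all points of the net in the cell, up to a small multiple of \<open>w\<close>,
  because \<open>F\<close> is Lipschitz and the grid is fine. After rounding, \<open>V\<close> is an integer vector, so adding it
  maps the integer lattice to itself and, as \<open>F\<close> is a bijection, induces an injective map \<open>Y\<close> on the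
  net. By the Lipschitz property of the inverse, \<open>Y\<close> takes a point to one near its translate by \<open>w\<close>;
  so all points of the dense cell that are not too close to its boundary are mapped into the sparse cell.
  But the dense cell has about three times as many points as the sparse cell. Surjectivity
  of \<open>F\<close> plays the role that the mapping degree has for homeomorphisms.\<close>
lemma no_translated_cell:
  fixes l :: nat and b :: "'n \<Rightarrow> int" and V :: "real ^ 'n"
  defines "w \<equiv> u (Suc l)" and "g \<equiv> B * u l"
  assumes l: "Suc l < J"
    and b0: "2 * w dvd b i0" and bg: "\<And>i. g dvd b i"
    and b_pos: "\<And>i. 0 \<le> b i" and b_le: "\<And>i. b i + w \<le> n" "b i0 + 2 * w \<le> n"
    and strips: "\<And>z l'. (\<And>i. i \<noteq> i0 \<Longrightarrow> b i \<le> z i \<and> z i < b i + w) \<Longrightarrow> Suc l \<le> l' \<Longrightarrow> l' < J \<Longrightarrow> in_strip l' z"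
    and tr: "\<And>e. (\<And>i. 0 \<le> e i \<and> e i < E) \<Longrightarrow>
       norm (F (\<lambda>i. b i + g * e i + (if i = i0 then w else 0)) - F (\<lambda>i. b i + g * e i) - V)
         \<le> real_of_int w / (24 * d * L)"
  shows False
proof -
  let ?D = "int CARD('n)"
  have w_pos: "w > 0" and g_pos: "g > 0" using u_pos B_pos by (auto simp: w_def g_def)
  have w_eq: "w = E * g" by (simp add: w_def g_def u_Suc)
  have "s dvd w" using u_dvd[of 0 "Suc l"] by (simp add: w_def u_def)
  then have "16 * ?D dvd w" using s_dvd by (rule dvd_trans[rotated])
  then obtain m' where "w = 16 * ?D * m'" by (auto elim: dvdE)
  then obtain m where m: "w = 8 * ?D * m" by (metis mult.assoc mult.commute mult_2 numeral_Bit0 numeral_times_numeral mult_numeral_left_semiring_numeral semiring_norm(13))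
  have m_pos: "m > 0" using m w_pos by (simp add: zero_less_mult_iff)
  have mw: "real_of_int m = real_of_int w / (8 * d)" using m d d_ge by simp
  have s_le: "s \<le> w" using \<open>s dvd w\<close> w_pos by (simp add: zdvd_imp_le)
  have D_m: "?D * m \<ge> 2 * m" using d2 m_pos by simp
  \<comment> \<open>All errors together must not exceed the margin \<open>m\<close>, the part \<open>1 / (8 * d)\<close> of the side of the cell:
      one third is granted to the mesh of the grid, one third to rounding, one third to the vector \<open>V\<close>.\<close>
  have e1: "L * (L * d * real_of_int g) + d * real_of_int g \<le> real_of_int w / (24 * d)"
  proof -
    have "24 * d * (L * (L * d * real_of_int g) + d * real_of_int g) = (24 * d\<^sup>2 * (L\<^sup>2 + 1)) * real_of_int g"
      by (simp add: algebra_simps power2_eq_square)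
    also have "\<dots> \<le> real_of_int E * real_of_int g" using E_large g_pos by (intro mult_right_mono) auto
    finally show ?thesis using d_ge w_eq by (simp add: field_simps)
  qed
  have e2: "L * d \<le> real_of_int w / (24 * d)"
  proof -
    have "24 * d\<^sup>2 * L \<le> real_of_int w" using s_large s_le by linarith
    then show ?thesis using d_ge by (simp add: field_simps power2_eq_square)
  qed
  define eta where "eta = L * d * real_of_int g + d + real_of_int w / (24 * d * L)"
  have e3: "L * eta + d * real_of_int g \<le> real_of_int m"
  proof -
    have "L * eta + d * real_of_int g = (L * (L * d * real_of_int g) + d * real_of_int g) + L * d + real_of_int w / (24 * d)"
      using L by (simp add: eta_def algebra_simps)
    moreover have "real_of_int m = 3 * (real_of_int w / (24 * d))" using mw by simp
    ultimately show ?thesis using e1 e2 by linarith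
  qed
  have eta0: "eta \<ge> 0" using L d_ge g_pos w_pos by (simp add: eta_def)
  have "eta \<le> L * eta" using L eta0 by (simp add: mult_le_cancel_right1)
  moreover have "d * real_of_int g \<ge> 0" using d_ge g_pos by simp
  ultimately have eta_m: "eta \<le> real_of_int m" using e3 by linarith
  have "m \<le> w" using m D_m m_pos by linarith
  also have "w \<le> n" using b_le(1)[of i0] b_pos[of i0] by linarith
  finally have "real_of_int m \<le> real_of_int n" by simp
  moreover have "1 * 1 \<le> L * d" using L d_ge by (intro mult_mono) auto
  then have "1 * real_of_int n \<le> L * d * real_of_int n"
    using \<open>w \<le> n\<close> w_pos by (intro mult_right_mono) auto
  ultimately have eta_n: "eta \<le> L * d * real_of_int n" using eta_m by linarith
  define v where "v i = round (V $ i)" for i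
  have v: "norm (lattice_point v - V) \<le> d"
    unfolding d
  proof (rule order_trans[OF norm_le_card_mult])
    show "\<bar>(lattice_point v - V) $ i\<bar> \<le> 1" for i
      using of_int_round_abs_le[of "V $ i"] by (simp add: v_def)
  qed simp
  have "\<exists>y. F y = F z + lattice_point v" for z
  proof -
    have "F z \<in> integer_lattice" using F by (auto simp: bij_betw_def)
    then have "F z + lattice_point v \<in> integer_lattice" by (auto simp: integer_lattice_def)
    then have "F z + lattice_point v \<in> range F" using F by (simp add: bij_betw_def)
    then show ?thesis by (metis rangeE)
  qed
  then obtain Y where Y: "\<And>z. F (Y z) = F z + lattice_point v" by metis
  have inj_Y: "inj Y"
  proof (rule injI)
    fix z z' assume "Y z = Y z'"
    then have "F z = F z'" using Y[of z] Y[of z'] by simp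
    then show "z = z'" using F by (auto simp: bij_betw_def inj_on_def)
  qed
  have in_box: "z \<in> int_box n" if "\<And>i. i \<noteq> i0 \<Longrightarrow> b i \<le> z i \<and> z i < b i + w" "b i0 \<le> z i0" "z i0 < b i0 + 2 * w" for z
    unfolding int_box_def
  proof (intro CollectI allI)
    fix i show "0 \<le> z i \<and> z i < n" using that b_pos[of i] b_le(1)[of i] b_le(2) by (cases "i = i0") force+
  qed
  \<comment> \<open>The parameter \<open>12 * d * m\<close>, three quarters of the period \<open>2 * w\<close>, is the one that is mapped to the
      boundary between the dense and the sparse cell. The margin \<open>3 * m\<close> along the fibre becomes \<open>2 * m\<close>
      after squeezing. Fibres in \<open>bad\<close> belong to strips of the next finer level, hence carry a different pattern.\<close>
  define bad where "bad i = {x \<in> {b i..<b i + E * g}. x mod g < u l}" for i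
  define S0 where "S0 = {b i0 + 3 * m..<b i0 + 12 * ?D * m - 3 * m}"
  define Dp where "Dp = {z. \<forall>i. z i \<in> (if i = i0 then S0 else {b i + m..<b i + w - m})}"
  define Bd where "Bd = {z. \<forall>i. z i \<in> (if i = i0 then S0 else bad i)}"
  define T1 where "T1 = {z. \<forall>i. z i \<in> (if i = i0 then {b i0 + 12 * ?D * m..<b i0 + 2 * w} else {b i..<b i + w})}"
  define T2 where "T2 = {z. \<forall>i. z i \<in> (if i = i0 then {b i0 + w..<b i0 + 2 * w} else bad i)}"
  have main: "Y z \<in> T1 \<union> T2" if z: "z \<in> Dp - Bd" for z
  proof -
    have z_in: "b i + m \<le> z i \<and> z i < b i + w - m" if "i \<noteq> i0" for i
      using z that by (auto simp: Dp_def split: if_splits)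
    have z0: "b i0 + 3 * m \<le> z i0" "z i0 < b i0 + 12 * ?D * m - 3 * m"
      using z by (auto simp: Dp_def S0_def split: if_splits)
    have z_cell: "b i \<le> z i \<and> z i < b i + w" if "i \<noteq> i0" for i using z_in[OF that] m_pos by linarith
    have not_strip: "\<not> in_strip l z"
    proof
      assume "in_strip l z"
      then have "z \<in> Bd" using z z_cell
        unfolding Bd_def Dp_def in_strip_def bad_def w_eq[symmetric] g_def[symmetric]
        by (auto split: if_splits)
      then show False using z by simp
    qed
    have z_box: "z \<in> int_box n" using z_cell z0 m m_pos by (intro in_box) auto
    have "width J z = width (Suc l) z" using l strips[OF z_cell] by (intro width_in_strips) auto
    then have Wz: "width J z = w" using not_strip by (simp add: w_def)
    define a where "a i = G z $ i - real_of_int (b i)" for i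
    have a: "real_of_int m \<le> a i \<and> a i < real_of_int w - real_of_int m" for i
    proof (cases "i = i0")
      case False
      then have "G z $ i = real_of_int (z i)" using G[OF z_box] by (simp add: patch_map_def)
      then show ?thesis using z_in[OF False] unfolding a_def by linarith
    next
      case True
      define t where "t = z i0 - b i0"
      have t: "3 * m \<le> t" "t < 12 * ?D * m - 3 * m" using z0 by (auto simp: t_def)
      have t2: "2 * t < 3 * w - 6 * m" using t m by linarith
      have "warp w (b i0 + t) = real_of_int (b i0) + max (2 / 3 * real_of_int t) (2 * real_of_int t - 2 * real_of_int w)"
        using t t2 m_pos w_pos b0 by (intro warp_add) linarith+
      moreover have "G z $ i0 = warp w (z i0)" using G[OF z_box] Wz by (simp add: patch_map_def)
      ultimately have "a i0 = max (2 / 3 * real_of_int t) (2 * real_of_int t - 2 * real_of_int w)"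
        by (simp add: a_def t_def)
      moreover have "2 * real_of_int t < 3 * real_of_int w - 6 * real_of_int m" "3 * real_of_int m \<le> real_of_int t"
        using t2 t(1) by linarith+
      ultimately show ?thesis using True m_pos by (auto simp: max_def)
    qed
    define e where "e i = \<lfloor>a i / real_of_int g\<rfloor>" for i
    have e_lo: "real_of_int g * real_of_int (e i) \<le> a i" and e_hi: "a i < real_of_int g * real_of_int (e i) + real_of_int g" for i
    proof -
      have "real_of_int (e i) \<le> a i / real_of_int g" "a i / real_of_int g < real_of_int (e i) + 1"
        unfolding e_def by linarith+
      then show "real_of_int g * real_of_int (e i) \<le> a i" "a i < real_of_int g * real_of_int (e i) + real_of_int g"
        using g_pos by (simp_all add: field_simps)
    qed
    have e: "0 \<le> e i \<and> e i < E" for i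
    proof
      have "a i > 0" using a[of i] m_pos by linarith
      then show "0 \<le> e i" using g_pos by (simp add: e_def)
      have "a i < real_of_int (E * g)" using a[of i] m_pos w_eq by linarith
      then have "a i / real_of_int g < real_of_int E" using g_pos by (simp add: field_simps)
      then show "e i < E" by (simp add: e_def floor_less_iff)
    qed
    have ge: "0 \<le> g * e i \<and> g * e i + g \<le> w" for i
    proof -
      have "g * e i + g = g * (e i + 1)" by (simp add: algebra_simps)
      also have "\<dots> \<le> g * E" using e[of i] g_pos by (intro mult_left_mono) auto
      finally show ?thesis using e[of i] g_pos w_eq by (simp add: mult.commute)
    qed
    define q where "q i = b i + g * e i" for i
    define q' where "q' i = b i + g * e i + (if i = i0 then w else 0)" for i
    have q_cell: "b i \<le> q i \<and> q i < b i + w" for i using ge[of i] g_pos by (auto simp: q_def)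
    have q'_cell: "i \<noteq> i0 \<Longrightarrow> b i \<le> q' i \<and> q' i < b i + w" for i using ge[of i] g_pos by (auto simp: q'_def)
    have q_box: "q \<in> int_box n" using q_cell q_cell[of i0] w_pos by (intro in_box) (blast, linarith, linarith)
    have q'_box: "q' \<in> int_box n" using q'_cell ge[of i0] g_pos w_pos by (intro in_box) (auto simp: q'_def)
    have q_dvd: "B * u l dvd q i" "B * u l dvd q' i" for i
      using bg[of i] w_eq by (auto simp: q_def q'_def g_def[symmetric])
    have Gq: "G q = lattice_point q"
      using l q_dvd q_box strips[of q] q_cell by (intro G_grid[of l]) auto
    have Gq': "G q' = lattice_point q'"
      using l q_dvd q'_box strips[of q'] q'_cell by (intro G_grid[of l]) auto
    have close: "\<bar>(G z - G q) $ i\<bar> \<le> real_of_int g" for i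
      using e_lo[of i] e_hi[of i] unfolding Gq by (simp add: q_def a_def)
    have "norm (G z - G q) \<le> d * real_of_int g"
      unfolding d using close by (intro norm_le_card_mult) auto
    then have "norm (F z - F q) \<le> L * (d * real_of_int g)"
      using lip[OF z_box q_box] L by (meson mult_left_mono order_trans zero_le_one)
    moreover have "norm (F q' - F q - V) \<le> real_of_int w / (24 * d * L)"
      using tr[OF e] unfolding q_def[abs_def] q'_def[abs_def] .
    moreover have "norm (F q' - F (Y z)) \<le> norm (F q' - F q - V) + norm (F z - F q) + norm (lattice_point v - V)"
    proof -
      have "F q' - F (Y z) = (F q' - F q - V) - (F z - F q) - (lattice_point v - V)" by (simp add: Y)
      then show ?thesis
        using order_trans[OF norm_triangle_ineq4 add_right_mono[OF norm_triangle_ineq4]] by metis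
    qed
    ultimately have "norm (F q' - F (Y z)) \<le> eta"
      using v unfolding eta_def mult.assoc by linarith
    then have "norm (G q' - G (Y z)) \<le> L * eta"
      using colip[OF q'_box, of "Y z"] eta_n L by (meson mult_left_mono order_trans zero_le_one)
    then have near: "\<bar>G q' $ i - G (Y z) $ i\<bar> \<le> L * eta" for i
      using component_le_norm_cart[of "G q' - G (Y z)" i] by (simp)
    have dg: "real_of_int g \<le> d * real_of_int g" using d_ge g_pos by simp
    have near2: "\<bar>G (Y z) $ i - (real_of_int (b i) + a i + (if i = i0 then real_of_int w else 0))\<bar> \<le> real_of_int m" for i
    proof -
      have "G q' $ i = G q $ i + (if i = i0 then real_of_int w else 0)"
        unfolding Gq Gq' by (simp add: q_def q'_def)
      then show ?thesis using near[of i] close[of i] e3 dg unfolding a_def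
        by (simp add: abs_le_iff)
    qed
    have y_in: "real_of_int (b i) \<le> G (Y z) $ i \<and> G (Y z) $ i < real_of_int (b i) + real_of_int w" if "i \<noteq> i0" for i
      using near2[of i] a[of i] that by (auto simp: abs_le_iff)
    have y0: "real_of_int (b i0) + real_of_int w \<le> G (Y z) $ i0" "G (Y z) $ i0 < real_of_int (b i0) + 2 * real_of_int w"
      using near2[of i0] a[of i0] by (auto simp: abs_le_iff)
    have y_box: "Y z \<in> int_box n"
    proof (rule G_box)
      fix i
      have "0 \<le> real_of_int (b i)" "real_of_int (b i) + real_of_int w \<le> real_of_int n"
        "real_of_int (b i0) + 2 * real_of_int w \<le> real_of_int n" "0 \<le> real_of_int w"
        using b_pos[of i] b_le(1)[of i] b_le(2) w_pos by linarith+
      then show "0 \<le> G (Y z) $ i \<and> G (Y z) $ i < real_of_int n"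
        using y_in[of i] y0 by (cases "i = i0") auto
    qed
    have y_cell: "b i \<le> Y z i \<and> Y z i < b i + w" if "i \<noteq> i0" for i
      using y_in[OF that] that unfolding G[OF y_box] by (simp add: patch_map_def)
    have Wy: "width J (Y z) = width (Suc l) (Y z)" using l strips[OF y_cell] by (intro width_in_strips) auto
    have G0: "G (Y z) $ i0 = warp (width (Suc l) (Y z)) (Y z i0)"
      unfolding G[OF y_box] patch_map_def using Wy by simp
    show ?thesis
    proof (cases "in_strip l (Y z)")
      case False
      then have wy: "width (Suc l) (Y z) = w" by (simp add: w_def)
      have "b i0 \<le> Y z i0" using warp_ge_iff[OF w_pos b0, of "Y z i0"] y0 w_pos G0 wy by simp
      moreover have "2 * w dvd b i0 + 2 * w" using b0 by simp
      from warp_ge_iff[OF w_pos this, of "Y z i0"] have "\<not> b i0 + 2 * w \<le> Y z i0" using y0 G0 wy by simp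
      moreover define t where "t = Y z i0 - b i0"
      ultimately have t: "0 \<le> t" "t < 2 * w" by auto
      have "warp w (b i0 + t) = real_of_int (b i0) + max (2 / 3 * real_of_int t) (2 * real_of_int t - 2 * real_of_int w)"
        using t w_pos b0 by (intro warp_add) auto
      then have "max (2 / 3 * real_of_int t) (2 * real_of_int t - 2 * real_of_int w) \<ge> real_of_int w"
        using y0 G0 wy by (simp add: t_def)
      then have "2 * real_of_int t \<ge> 3 * real_of_int w" by (auto simp: max_def split: if_splits)
      then have "2 * t \<ge> 3 * w" by linarith
      then have "t \<ge> 12 * ?D * m" using m by linarith
      then have "Y z \<in> T1" using y_cell t unfolding T1_def t_def by auto
      then show ?thesis by simp
    next
      case True
      define w' where "w' = width l (Y z)"
      have w': "width (Suc l) (Y z) = w'" "w' > 0" using True width_pos by (auto simp: w'_def)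
      have "2 * w' dvd 2 * u l" using width_dvd by (simp add: w'_def)
      then have w'g: "2 * w' dvd g" using two_u_dvd[of l] unfolding g_def by (rule dvd_trans)
      then have w'w: "2 * w' dvd w" using w_eq by simp
      have "2 * w' dvd b i0" using w'g bg by (rule dvd_trans)
      then have dv: "2 * w' dvd b i0 + w" "2 * w' dvd b i0 + 2 * w" using w'w by (auto intro: dvd_mult)
      have "b i0 + w \<le> Y z i0" using warp_ge_iff[OF w'(2) dv(1), of "Y z i0"] y0 G0 w'(1) by simp
      moreover have "\<not> b i0 + 2 * w \<le> Y z i0" using warp_ge_iff[OF w'(2) dv(2), of "Y z i0"] y0 G0 w'(1) by simp
      ultimately have "Y z \<in> T2"
        using y_cell True unfolding T2_def bad_def in_strip_def w_eq[symmetric] g_def[symmetric] by auto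
      then show ?thesis by simp
    qed
  qed
  \<comment> \<open>It remains to see that \<open>Dp - Bd\<close> has more elements than \<open>T1 \<union> T2\<close>. With \<open>x = w\<close> and \<open>P = x ^ (d - 1)\<close>
      the sets \<open>Dp\<close> and \<open>T1\<close> have at least \<open>27/32 * x * P\<close> and at most \<open>16/32 * x * P\<close> elements, while
      \<open>Bd\<close> and \<open>T2\<close> together contribute at most \<open>8/32 * x * P\<close>.\<close>
  let ?N = "CARD('n) - 1"
  define h where "h = E * u l"
  have h_pos: "h > 0" using E_pos u_pos by (simp add: h_def)
  have w_h: "w = B * h" by (simp add: h_def w_eq g_def)
  have card_bad: "card (bad i) \<le> nat h" for i
    unfolding bad_def h_def using g_pos E_pos u_pos bg by (intro card_residues_less) (auto simp: less_imp_le)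
  have fin_bad: "finite (bad i)" for i unfolding bad_def by (rule finite_subset[of _ "{b i..<b i + E * g}"]) auto
  have S0: "card S0 = nat (12 * ?D * m - 6 * m)" unfolding S0_def by (simp add: algebra_simps)
  have fin: "finite Dp" "card Dp = card S0 * nat (w - 2 * m) ^ ?N"
    using card_box[of "\<lambda>i. if i = i0 then S0 else {b i + m..<b i + w - m}" i0 "nat (w - 2 * m)"]
    by (auto simp: Dp_def S0_def algebra_simps)
  have Bd: "finite Bd" "card Bd \<le> card S0 * nat h ^ ?N"
    using card_box_le[of "\<lambda>i. if i = i0 then S0 else bad i" i0 "nat h"] card_bad fin_bad
    by (auto simp: Bd_def S0_def)
  have T1: "finite T1" "card T1 \<le> nat (2 * w - 12 * ?D * m) * nat w ^ ?N"
    using card_box_le[of "\<lambda>i. if i = i0 then {b i0 + 12 * ?D * m..<b i0 + 2 * w} else {b i..<b i + w}" i0 "nat w"]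
    by (auto simp: T1_def algebra_simps)
  have T2: "finite T2" "card T2 \<le> nat w * nat h ^ ?N"
    using card_box_le[of "\<lambda>i. if i = i0 then {b i0 + w..<b i0 + 2 * w} else bad i" i0 "nat h"] card_bad fin_bad
    by (auto simp: T2_def)
  have "card (Dp - Bd) \<le> card (T1 \<union> T2)"
    using inj_Y main T1 T2 by (intro card_inj_on_le[of Y]) (auto intro: inj_on_subset)
  also have "\<dots> \<le> card T1 + card T2" by (rule card_Un_le)
  finally have "card Dp \<le> card Bd + card T1 + card T2"
    using diff_card_le_card_Diff[OF Bd(1), of Dp] by linarith
  then have "card S0 * nat (w - 2 * m) ^ ?N \<le> card S0 * nat h ^ ?N + nat (2 * w - 12 * ?D * m) * nat w ^ ?N + nat w * nat h ^ ?N"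
    using fin Bd T1 T2 by linarith
  then have "real (card S0 * nat (w - 2 * m) ^ ?N) \<le> real (card S0 * nat h ^ ?N + nat (2 * w - 12 * ?D * m) * nat w ^ ?N + nat w * nat h ^ ?N)"
    by (simp only: of_nat_le_iff)
  moreover have pos: "12 * ?D * m - 6 * m \<ge> 0" "w - 2 * m \<ge> 0" "2 * w - 12 * ?D * m \<ge> 0"
    using m D_m m_pos by auto
  ultimately have ineq: "(3 / 2 * x - 6 * y) * (x - 2 * y) ^ ?N \<le> (3 / 2 * x - 6 * y) * z ^ ?N + x / 2 * x ^ ?N + x * z ^ ?N"
    if "x = real_of_int w" "y = real_of_int m" "z = real_of_int h" for x y z :: real
  proof -
    have "real (card S0) = 3 / 2 * x - 6 * y" using pos m unfolding S0 that by simp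
    moreover have "real (nat (2 * w - 12 * ?D * m)) = x / 2" using pos m unfolding that by simp
    ultimately show ?thesis
      using \<open>real _ \<le> real _\<close> pos h_pos w_pos unfolding that by simp
  qed
  define x y z where "x = real_of_int w" and "y = real_of_int m" and "z = real_of_int h"
  note ineq = ineq[OF x_def y_def z_def]
  have x_pos: "x > 0" using w_pos by (simp add: x_def)
  define P where "P = x ^ ?N"
  have P_pos: "P > 0" using x_pos by (simp add: P_def)
  have y_eq: "y = x / (8 * d)" using mw by (simp add: x_def y_def)
  have y_le: "y \<le> x / 16" using d_ge x_pos unfolding y_eq by (simp add: field_simps)
  have bern: "(x - 2 * y) ^ ?N \<ge> 3 / 4 * P"
  proof -
    have "1 + real ?N * (- (1 / (4 * d))) \<le> (1 + (- (1 / (4 * d)))) ^ ?N"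
      using d_ge by (intro Bernoulli_inequality) (simp add: field_simps)
    moreover have "real ?N * (1 / (4 * d)) \<le> 1 / 4"
      using d d_ge by (simp add: field_simps of_nat_diff)
    moreover have "1 + real ?N * (- (1 / (4 * d))) = 1 - real ?N * (1 / (4 * d))" by (simp only: mult_minus_right diff_conv_add_uminus)
    ultimately have "3 / 4 \<le> (1 + (- (1 / (4 * d)))) ^ ?N" by linarith
    then have "3 / 4 \<le> (1 - 1 / (4 * d)) ^ ?N" by (simp only: diff_conv_add_uminus)
    then have "3 / 4 * P \<le> (1 - 1 / (4 * d)) ^ ?N * P" using P_pos by (intro mult_right_mono) auto
    also have "\<dots> = ((1 - 1 / (4 * d)) * x) ^ ?N" by (simp add: P_def power_mult_distrib)
    also have "(1 - 1 / (4 * d)) * x = x - 2 * y" using d_ge unfolding y_eq by (simp add: field_simps)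
    finally show ?thesis .
  qed
  have z: "z ^ ?N \<le> P / 10"
  proof -
    have z_pos: "z > 0" using h_pos by (simp add: z_def)
    have xz: "x = real_of_int B * z" using w_h by (simp add: x_def z_def)
    have "real_of_int B \<ge> 10" using B_large by simp
    then have "10 * z \<le> x" using z_pos unfolding xz by (intro mult_right_mono) auto
    moreover obtain k where k: "?N = Suc k" using d2 by (cases ?N) auto
    have "z ^ k \<le> x ^ k" using z_pos \<open>10 * z \<le> x\<close> by (intro power_mono) auto
    ultimately have "(10 * z) * z ^ k \<le> x * x ^ k" using z_pos x_pos by (intro mult_mono) auto
    then show ?thesis unfolding P_def k by simp
  qed
  have "27 / 32 * (x * P) = (9 / 8 * x) * (3 / 4 * P)" by simp
  also have "\<dots> \<le> (3 / 2 * x - 6 * y) * (x - 2 * y) ^ ?N"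
    using bern y_le x_pos P_pos by (intro mult_mono) auto
  also have "\<dots> \<le> (3 / 2 * x - 6 * y) * z ^ ?N + x / 2 * P + x * z ^ ?N" using ineq by (simp add: P_def)
  also have "\<dots> \<le> (3 / 2 * x) * (P / 10) + x / 2 * P + x * (P / 10)"
  proof -
    have "z ^ ?N \<ge> 0" using h_pos by (simp add: z_def)
    moreover have "y \<ge> 0" using m_pos by (simp add: y_def)
    ultimately have "(3 / 2 * x - 6 * y) * z ^ ?N \<le> (3 / 2 * x) * (P / 10)"
      using z x_pos by (intro mult_mono) linarith+
    moreover have "x * z ^ ?N \<le> x * (P / 10)" using z x_pos by (intro mult_left_mono) linarith+
    ultimately show ?thesis by linarith
  qed
  also have "\<dots> = 24 / 32 * (x * P)" by (simp add: field_simps)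
  finally show False using x_pos P_pos by (simp add: mult_le_cancel_right)
qed

end

section \<open>Stretched pairs at ever smaller scales\<close>
definition shift :: "'n \<Rightarrow> int \<Rightarrow> ('n \<Rightarrow> int) \<Rightarrow> 'n \<Rightarrow> int" where
  "shift i0 t z = (\<lambda>i. z i + (if i = i0 then t else 0))"

context bilipschitz_patch
begin

text \<open>A node of level \<open>l\<close> is the left end of a pair with distance \<open>u (Suc l)\<close>: a grid point in the corner
  of a strip of level \<open>l\<close> which is contained in strips of all higher levels.\<close>
definition node :: "nat \<Rightarrow> ('n \<Rightarrow> int) \<Rightarrow> bool" where
  "node l p \<longleftrightarrow> (\<forall>i. B * u l dvd p i) \<and> (\<forall>l'. l < l' \<and> l' < J \<longrightarrow> in_strip l' p)"

lemma G_node: "l < J \<Longrightarrow> node l q \<Longrightarrow> q \<in> int_box n \<Longrightarrow> G q = lattice_point q"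
  by (rule G_grid) (auto simp: node_def)

lemma node_shift: "node l p \<Longrightarrow> B * u l dvd t \<Longrightarrow> node l (shift i0 t p)"
  by (simp add: node_def shift_def in_strip_def)

lemma node_strips:
  assumes p: "node l p" and z: "\<And>i. i \<noteq> i0 \<Longrightarrow> p i \<le> z i \<and> z i < p i + u l" and l': "l \<le> l'" "l' < J"
  shows "in_strip l' z"
proof -
  have ul: "0 < u l" "u l \<le> B * u l" using B_pos u_pos by auto
  show ?thesis
  proof (cases "l = l'")
    case True
    show ?thesis unfolding in_strip_def
    proof (intro allI impI)
      fix i assume i: "i \<noteq> i0"
      have "B * u l dvd p i" using p by (simp add: node_def)
      then obtain c where c: "p i = B * u l * c" by (rule dvdE)
      then have "z i mod (B * u l) = z i - p i"
        using z[OF i] ul c by (intro int_mod_pos_eq[of _ _ c]) linarith+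
      then show "z i mod (B * u l') < u l'" using z[OF i] True by simp
    qed
  next
    case False
    then have "l < l'" using l' by simp
    moreover have "in_strip l' p" using p l' False by (simp add: node_def)
    moreover have "p i \<le> z i \<and> z i < p i + B * u l" if "i \<noteq> i0" for i using z[OF that] ul by linarith
    moreover have "B * u l dvd p i" for i using p by (simp add: node_def)
    ultimately show ?thesis using in_strip_near_grid[of l' p l z] by blast
  qed
qed

lemma node_Suc:
  assumes "node (Suc l) p"
  shows "node l p"
  unfolding node_def
proof (intro conjI allI impI)
  fix i show "B * u l dvd p i"
    using assms unfolding node_def by (intro dvd_trans[OF Bu_dvd[of l "Suc l"]]) auto
next
  fix l' assume "l < l' \<and> l' < J"
  then show "in_strip l' p" using u_pos[of "Suc l"] by (intro node_strips[OF assms]) auto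
qed

lemma stretch_le:
  assumes "l < J" "node l p" "node l q" "p \<in> int_box n" "q \<in> int_box n"
  shows "norm (F p - F q) \<le> L * norm (lattice_point p - lattice_point q)"
  using lip[OF assms(4,5)] G_node[OF assms(1,2,4)] G_node[OF assms(1,3,5)] by simp

lemma norm_shift: "norm (lattice_point (shift i0 t p) - lattice_point p) = \<bar>real_of_int t\<bar>"
proof -
  have "lattice_point (shift i0 t p) - lattice_point p = axis i0 (real_of_int t)"
    by (auto simp: vec_eq_iff shift_def axis_def)
  then show ?thesis by (simp add: norm_eq_sqrt_inner inner_axis_axis)
qed

text \<open>The segment from \<open>p\<close> to \<open>p + N\<close> consists of \<open>E * B\<close> cells of side \<open>w\<close>, alternatingly dense and
  sparse, and each grid point of a cell is a node of level \<open>l\<close>. Join corresponding grid points of consecutive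
  cells to chains. If no pair of the finer level were stretched noticeably more than the given
  pair, then no link of a chain could be much longer than the average, although each chain as a whole is
  stretched nearly as much as the segment, because its ends are close to those of the segment. So
  the links would have to be almost parallel and of equal length, and at some position the image of a
  dense cell would be a translate of the image of the following sparse cell.\<close>
lemma stretch_step:
  fixes l :: nat and p :: "'n \<Rightarrow> int"
  defines "w \<equiv> u (Suc l)" and "N \<equiv> u (Suc (Suc l))"
  assumes l: "Suc l < J" and p: "node (Suc l) p" "p \<in> int_box n" "shift i0 N p \<in> int_box n"
  obtains q where "node l q" "q \<in> int_box n" "shift i0 w q \<in> int_box n"
    "norm (F (shift i0 w q) - F q) / real_of_int w
       \<ge> (1 + 1 / real_of_int (E * B)) * (norm (F (shift i0 N p) - F p) / real_of_int N)"
proof (rule ccontr)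
  assume "\<not> thesis"
  note no_q = this and witness = that
  define A where "A = norm (F (shift i0 N p) - F p) / real_of_int N"
  define g where "g = B * u l"
  obtain B' where B': "B = 2 * B'" using B_even by (auto elim: evenE)
  define m where "m = nat (E * B')"
  have B'_pos: "B' > 0" using B' B_pos by simp
  have EB: "E * B = 2 * int m" using B' E_pos B'_pos by (simp add: m_def)
  have m_pos: "m > 0" using E_pos B'_pos by (simp add: m_def)
  have w_pos: "w > 0" and g_pos: "g > 0" and N_pos: "N > 0" using u_pos B_pos by (auto simp: w_def g_def N_def)
  have w_eq: "w = E * g" by (simp add: w_def g_def u_Suc)
  have N_eq: "N = 2 * int m * w" using EB by (simp add: N_def w_def u_Suc[of "Suc l"])
  have gw: "g dvd w" using w_eq by simp
  have Bw: "B * w dvd p i" "g dvd p i" for i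
    using p(1) w_eq dvd_trans[of g "B * w" "p i"] by (auto simp: node_def w_def)
  have p_lo: "0 \<le> p i" for i using p(2) by (simp add: int_box_def)
  have p_hi: "p i0 + N < n" using p(3) by (auto simp: int_box_def shift_def dest: spec[of _ i0])
  have p_hi': "p i + w \<le> n" for i
  proof -
    have "B * w dvd n - p i" using Bw(1)[of i] Bu_dvd_u[OF l] n by (simp add: w_def)
    moreover have "n - p i > 0" using p(2) by (simp add: int_box_def)
    ultimately have "B * w \<le> n - p i" by (rule zdvd_imp_le)
    moreover have "1 * w \<le> B * w" using B_pos w_pos by (intro mult_right_mono) auto
    ultimately show ?thesis by simp
  qed
  define Q where "Q = {e :: 'n \<Rightarrow> int. \<forall>i. e i \<in> {0..<E}}"
  have finQ: "finite Q" and cardQ: "card Q = nat E ^ CARD('n)"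
  proof -
    have "finite Q" "card Q = nat E * nat E ^ (CARD('n) - 1)"
      using card_box[of "\<lambda>_. {0..<E}" i0 "nat E"] by (auto simp: Q_def)
    then show "finite Q" "card Q = nat E ^ CARD('n)"
      using d2 by (simp_all add: power_eq_if)
  qed
  \<comment> \<open>\<open>cell e i\<close> is the grid point with index \<open>e\<close> in the \<open>i\<close>-th cell of the segment.\<close>
  define cell where "cell e i = (\<lambda>k. p k + g * e k + (if k = i0 then int i * w else 0))" for e i
  have ge: "0 \<le> g * e k \<and> g * e k < w" if "e \<in> Q" for e k
  proof -
    have "0 \<le> e k" "e k < E" using that by (auto simp: Q_def)
    then show ?thesis using g_pos w_eq by (simp add: mult.commute)
  qed
  have cell_box: "cell e i \<in> int_box n" if e: "e \<in> Q" and i: "i < 2 * m" for e i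
    unfolding int_box_def
  proof (intro CollectI allI)
    fix k
    have "(int i + 1) * w \<le> 2 * int m * w" using i w_pos by (intro mult_right_mono) auto
    then have "int i * w + w \<le> N" using N_eq by (simp add: algebra_simps)
    moreover have "int i * w \<ge> 0" using w_pos by simp
    ultimately show "0 \<le> cell e i k \<and> cell e i k < n"
      using ge[OF e, of k] p_lo[of k] p_hi p_hi'[of k] unfolding cell_def by (cases "k = i0") auto
  qed
  have cell_node: "node l (cell e i)" if e: "e \<in> Q" for e i
    unfolding node_def
  proof (intro conjI allI impI)
    fix k show "B * u l dvd cell e i k"
      using Bw(2)[of k] gw by (auto simp: cell_def g_def[symmetric])
  next
    fix l' assume l': "l < l' \<and> l' < J"
    then show "in_strip l' (cell e i)"
      using ge[OF e] by (intro node_strips[OF p(1)]) (auto simp: cell_def w_def[symmetric])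
  qed
  have cell_Suc: "cell e (Suc i) = shift i0 w (cell e i)" for e i
    by (auto simp: cell_def shift_def algebra_simps)
  define v where "v = F (shift i0 N p) - F p"
  have node_N: "node (Suc l) (shift i0 N p)"
    using p(1) Bu_dvd_u[of "Suc l" "Suc (Suc l)"] by (intro node_shift) (auto simp: N_def)
  have "shift i0 N p \<noteq> p" using N_pos by (auto simp: shift_def fun_eq_iff)
  then have v0: "v \<noteq> 0" using F by (auto simp: v_def bij_betw_def inj_on_def)
  have vA: "norm v = A * real_of_int N" using N_pos by (simp add: A_def v_def)
  have A_pos: "A > 0" using v0 N_pos by (simp add: A_def v_def)
  have "norm v \<le> L * real_of_int N"
    using stretch_le[OF l node_N p(1) p(3,2)] N_pos by (simp add: v_def norm_shift)
  then have A_le: "A \<le> L" using N_pos unfolding vA by simp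
  define Z where "Z = (1 + 1 / real_of_int (E * B)) * A * real_of_int w"
  have m1: "1 / real_of_int (E * B) = 1 / (2 * real m)" using EB by simp
  have Z_pos: "Z \<ge> 0" using A_pos w_pos unfolding Z_def m1 by simp
  \<comment> \<open>The ends of a chain have distance at most \<open>d * w\<close> to the ends of the segment.\<close>
  define c where "c = 2 * L * d * real_of_int w"
  define D where "D e i = F (cell e (Suc i)) - F (cell e i)" for e i
  have D_le: "norm (D e i) \<le> Z" if e: "e \<in> Q" and i: "i < 2 * m - 1" for e i
  proof (rule ccontr)
    assume "\<not> ?thesis"
    then have "norm (F (shift i0 w (cell e i)) - F (cell e i)) \<ge> Z" by (simp add: D_def cell_Suc)
    then have "norm (F (shift i0 w (cell e i)) - F (cell e i)) / real_of_int w \<ge> (1 + 1 / real_of_int (E * B)) * A"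
      using w_pos by (simp add: Z_def pos_le_divide_eq)
    moreover have "cell e i \<in> int_box n" "shift i0 w (cell e i) \<in> int_box n"
      using cell_box[OF e, of i] cell_box[OF e, of "Suc i"] i by (auto simp: cell_Suc)
    ultimately show False using no_q witness[OF cell_node[OF e, of i]] unfolding A_def by blast
  qed
  have D_sum: "(\<Sum>i<2 * m - 1. D e i \<bullet> sgn v) \<ge> real (2 * m - 1) * Z - c" if e: "e \<in> Q" for e
  proof -
    define k where "k = 2 * m - 1"
    have k: "k < 2 * m" "int k = 2 * int m - 1" using m_pos by (auto simp: k_def)
    have Dk: "(\<Sum>i<k. D e i) = F (cell e k) - F (cell e 0)"
      unfolding D_def by (rule sum_lessThan_telescope)
    have sgn_le: "\<bar>x \<bullet> sgn v\<bar> \<le> norm x" for x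
      using Cauchy_Schwarz_ineq2[of x "sgn v"] v0 by (simp add: norm_sgn)
    have "norm (F (cell e k) - F (shift i0 N p)) \<le> L * (d * real_of_int w)"
    proof -
      have "norm (lattice_point (cell e k) - lattice_point (shift i0 N p) :: real ^ 'n) \<le> d * real_of_int w"
        unfolding d
      proof (rule norm_le_card_mult)
        fix j
        have "\<bar>cell e k j - shift i0 N p j\<bar> \<le> w"
        proof (cases "j = i0")
          case True
          have "int k * w - N = - w" unfolding k(2) N_eq by (simp add: left_diff_distrib)
          then show ?thesis using ge[OF e, of j] True by (simp add: cell_def shift_def)
        qed (use ge[OF e, of j] in \<open>simp add: cell_def shift_def\<close>)
        then show "\<bar>(lattice_point (cell e k) - lattice_point (shift i0 N p)) $ j\<bar> \<le> real_of_int w"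
          by (simp flip: of_int_diff of_int_abs)
      qed
      then have "L * norm (lattice_point (cell e k) - lattice_point (shift i0 N p) :: real ^ 'n) \<le> L * (d * real_of_int w)"
        using L by (intro mult_left_mono) auto
      then show ?thesis
        using stretch_le[OF Suc_lessD[OF l] cell_node[OF e] node_Suc[OF node_N] cell_box[OF e k(1)] p(3)] by linarith
    qed
    moreover have "norm (F (cell e 0) - F p) \<le> L * (d * real_of_int w)"
    proof -
      have "norm (lattice_point (cell e 0) - lattice_point p :: real ^ 'n) \<le> d * real_of_int w"
        unfolding d
      proof (rule norm_le_card_mult)
        fix j
        have "\<bar>cell e 0 j - p j\<bar> \<le> w"
          using ge[OF e, of j] by (auto simp: cell_def)
        then show "\<bar>(lattice_point (cell e 0) - lattice_point p) $ j\<bar> \<le> real_of_int w"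
          by (simp flip: of_int_diff of_int_abs)
      qed
      then have "L * norm (lattice_point (cell e 0) - lattice_point p :: real ^ 'n) \<le> L * (d * real_of_int w)"
        using L by (intro mult_left_mono) auto
      moreover have "cell e 0 \<in> int_box n" using m_pos by (intro cell_box[OF e]) simp
      ultimately show ?thesis
        using stretch_le[OF Suc_lessD[OF l] cell_node[OF e] node_Suc[OF p(1)] _ p(2)] by fastforce
    qed
    moreover have "(\<Sum>i<k. D e i \<bullet> sgn v)
      = v \<bullet> sgn v + (F (cell e k) - F (shift i0 N p)) \<bullet> sgn v - (F (cell e 0) - F p) \<bullet> sgn v"
      unfolding inner_sum_left[symmetric] Dk v_def by (simp add: inner_diff_left algebra_simps)
    moreover have "v \<bullet> sgn v = norm v"
      using v0 by (simp add: sgn_div_norm power2_norm_eq_inner[symmetric] power2_eq_square)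
    ultimately have "(\<Sum>i<k. D e i \<bullet> sgn v) \<ge> norm v - c"
      using sgn_le[of "F (cell e k) - F (shift i0 N p)"] sgn_le[of "F (cell e 0) - F p"]
      unfolding c_def by (simp add: abs_le_iff algebra_simps)
    moreover have "real k * Z \<le> norm v"
    proof -
      have rk: "real k = 2 * real m - 1" using k m_pos by (simp add: k_def of_nat_diff)
      have "real k * (1 + 1 / (2 * real m)) \<le> 2 * real m"
        unfolding rk using m_pos by (simp add: field_simps)
      then have "real k * (1 + 1 / (2 * real m)) * (A * real_of_int w) \<le> 2 * real m * (A * real_of_int w)"
        using A_pos w_pos by (intro mult_right_mono) auto
      then show ?thesis unfolding vA Z_def m1 N_eq by (simp add: algebra_simps)
    qed
    ultimately show ?thesis by (simp add: k_def)
  qed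
  have nsgn: "norm (sgn v) = 1" using v0 by (simp add: norm_sgn)
  obtain j where j: "j < m"
    and par: "\<And>e. e \<in> Q \<Longrightarrow> (norm (D e (2 * j) - Z *\<^sub>R sgn v))\<^sup>2 \<le> 2 * Z * (real (card Q) * c / real m)"
    using almost_parallel[of Q m "sgn v" Z D c] finQ m_pos nsgn Z_pos D_le D_sum by blast
  have bound: "2 * Z * (real (card Q) * c / real m) \<le> (real_of_int w / (24 * d * L))\<^sup>2"
  proof -
    define X where "X = real_of_int E ^ CARD('n)"
    have X: "real (card Q) = X" using E_pos by (simp add: cardQ X_def)
    have X_pos: "X > 0" using E_pos by (simp add: X_def)
    have dL: "24 * d * L > 0" using d_ge L by simp
    have Bm: "real_of_int B \<le> 2 * real m"
    proof -
      have "1 * B \<le> E * B" using E_pos B_pos by (intro mult_right_mono) auto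
      then show ?thesis using EB by linarith
    qed
    have "1 / (2 * real m) \<le> 1" using m_pos by simp
    then have "(1 + 1 / (2 * real m)) * A \<le> 2 * L" using A_pos A_le by (intro mult_mono) auto
    then have "Z \<le> 2 * L * real_of_int w" unfolding Z_def m1 using w_pos by (intro mult_right_mono) auto
    then have "2 * Z * (X * c / real m) \<le> 2 * (2 * L * real_of_int w) * (X * c / real m)"
      using X_pos L d_ge w_pos by (intro mult_right_mono) (auto simp: c_def)
    also have "\<dots> = 16 * L\<^sup>2 * d * X * (real_of_int w)\<^sup>2 / (2 * real m)"
      by (simp add: c_def power2_eq_square)
    also have "\<dots> \<le> 16 * L\<^sup>2 * d * X * (real_of_int w)\<^sup>2 / real_of_int B"
      using Bm B_pos X_pos L d_ge by (intro divide_left_mono) auto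
    also have "\<dots> \<le> (real_of_int w)\<^sup>2 / (24 * d * L)\<^sup>2"
    proof -
      have "16 * L\<^sup>2 * d * X * (24 * d * L)\<^sup>2 \<le> 8 * L\<^sup>2 * (2 * d + 1) * X * (24 * d * L)\<^sup>2"
        using X_pos by (intro mult_right_mono) (auto simp: algebra_simps)
      also have "\<dots> \<le> real_of_int B" using B_large(2) by (simp add: X_def)
      finally have "16 * L\<^sup>2 * d * X * (24 * d * L)\<^sup>2 * (real_of_int w)\<^sup>2 \<le> real_of_int B * (real_of_int w)\<^sup>2"
        by (intro mult_right_mono) auto
      moreover have "(24 * d * L)\<^sup>2 > 0" by (rule zero_less_power[OF dL])
      ultimately show ?thesis using B_pos by (intro divide_le_divide_cross) (simp_all only: of_int_0_less_iff mult_ac)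
    qed
    finally show ?thesis unfolding X by (simp add: power_divide)
  qed
  define b where "b = cell (\<lambda>_. 0) (2 * j)"
  show False
  proof (rule no_translated_cell[of l b "Z *\<^sub>R sgn v"])
    show "Suc l < J" by (rule l)
    have jm: "(2 * int j + 2) * w \<le> 2 * int m * w" using j w_pos by (intro mult_right_mono) auto
    have "2 * w dvd p i0" using Bw(1)[of i0] two_u_dvd[of "Suc l"] by (auto simp: w_def intro: dvd_trans)
    then show "2 * u (Suc l) dvd b i0" by (simp add: b_def cell_def w_def[symmetric])
    show "B * u l dvd b i" for i using Bw(2)[of i] gw by (simp add: b_def cell_def g_def[symmetric])
    show "0 \<le> b i" for i using p_lo[of i] w_pos by (simp add: b_def cell_def)
    show "b i0 + 2 * u (Suc l) \<le> n"
      using jm p_hi N_eq by (simp add: b_def cell_def w_def[symmetric] algebra_simps)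
    then show "b i + u (Suc l) \<le> n" for i
      using p_hi'[of i] w_pos by (cases "i = i0") (auto simp: b_def cell_def w_def[symmetric])
    show "in_strip l' z" if "\<And>i. i \<noteq> i0 \<Longrightarrow> b i \<le> z i \<and> z i < b i + u (Suc l)" "Suc l \<le> l'" "l' < J" for z l'
      using that by (intro node_strips[OF p(1)]) (auto simp: b_def cell_def)
    show "norm (F (\<lambda>i. b i + B * u l * e i + (if i = i0 then u (Suc l) else 0)) - F (\<lambda>i. b i + B * u l * e i)
          - Z *\<^sub>R sgn v) \<le> real_of_int (u (Suc l)) / (24 * d * L)" if e: "\<And>i. 0 \<le> e i \<and> e i < E" for e
    proof -
      have eQ: "e \<in> Q" using e by (simp add: Q_def)
      have "(\<lambda>i. b i + B * u l * e i) = cell e (2 * j)"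
        by (auto simp: b_def cell_def g_def)
      moreover have "(\<lambda>i. b i + B * u l * e i + (if i = i0 then u (Suc l) else 0)) = cell e (Suc (2 * j))"
        by (auto simp: b_def cell_def g_def w_def algebra_simps)
      moreover have "0 \<le> real_of_int w / (24 * d * L)" using w_pos d_ge L by simp
      then have "norm (D e (2 * j) - Z *\<^sub>R sgn v) \<le> real_of_int w / (24 * d * L)"
        using order_trans[OF par[OF eQ] bound] by (rule power2_le_imp_le[rotated])
      ultimately show ?thesis by (simp add: D_def w_def)
    qed
  qed
qed

text \<open>Half of an edge of the cube is shrunk by at most the factor \<open>L\<close>. Starting from it, the stretch grows by
  a fixed factor with each level. As it cannot exceed \<open>L\<close>, there cannot be too many levels.\<close>
lemma stretch_chain:
  assumes "k < J"
  shows "\<exists>p. node (J - 1 - k) p \<and> p \<in> int_box n \<and> shift i0 (u (J - k)) p \<in> int_box n \<and>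
    norm (F (shift i0 (u (J - k)) p) - F p) / real_of_int (u (J - k)) \<ge> (1 + 1 / real_of_int (E * B)) ^ k / L"
  using assms
proof (induction k)
  case 0
  define p :: "'n \<Rightarrow> int" where "p = (\<lambda>_. 0)"
  have node: "node (J - 1) p" using u_pos by (auto simp: node_def p_def in_strip_def)
  have int_box: "p \<in> int_box n" "shift i0 (u J) p \<in> int_box n" using u_pos[of J] by (auto simp: int_box_def p_def n shift_def)
  have node': "node (J - 1) (shift i0 (u J) p)"
    using 0 Bu_dvd_u[of "J - 1" J] by (intro node_shift[OF node]) simp
  have Gp: "G p = lattice_point p" "G (shift i0 (u J) p) = lattice_point (shift i0 (u J) p)"
    using 0 G_node[of "J - 1"] node node' int_box by auto
  have uJ: "real_of_int (u J) > 0" using u_pos by simp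
  have "norm (F (shift i0 (u J) p) - F p) \<le> L * real_of_int (u J)"
    using stretch_le[OF _ node' node int_box(2,1)] 0 uJ by (simp add: norm_shift)
  also have "\<dots> \<le> L * d * real_of_int n"
  proof -
    have "1 * real_of_int (u J) \<le> d * (2 * real_of_int (u J))" using d_ge uJ by (intro mult_mono) auto
    then show ?thesis using L n by (simp add: mult.assoc)
  qed
  finally have "norm (G (shift i0 (u J) p) - G p) \<le> L * norm (F (shift i0 (u J) p) - F p)"
    using colip int_box(2) by blast
  then have "real_of_int (u J) \<le> L * norm (F (shift i0 (u J) p) - F p)" using uJ by (simp add: Gp norm_shift)
  then have "1 / L \<le> norm (F (shift i0 (u J) p) - F p) / real_of_int (u J)"
    using L uJ by (simp add: field_simps)
  then show ?case using node int_box by auto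
next
  case (Suc k)
  define l where "l = J - 1 - Suc k"
  have l: "Suc l < J" "J - 1 - k = Suc l" "J - k = Suc (Suc l)" "J - Suc k = Suc l"
    using Suc.prems by (auto simp: l_def)
  obtain p where p: "node (Suc l) p" "p \<in> int_box n" "shift i0 (u (Suc (Suc l))) p \<in> int_box n"
    "norm (F (shift i0 (u (Suc (Suc l))) p) - F p) / real_of_int (u (Suc (Suc l))) \<ge> (1 + 1 / real_of_int (E * B)) ^ k / L"
    using Suc.IH Suc.prems unfolding l by auto
  obtain q where q: "node l q" "q \<in> int_box n" "shift i0 (u (Suc l)) q \<in> int_box n"
    "norm (F (shift i0 (u (Suc l)) q) - F q) / real_of_int (u (Suc l))
       \<ge> (1 + 1 / real_of_int (E * B)) * (norm (F (shift i0 (u (Suc (Suc l))) p) - F p) / real_of_int (u (Suc (Suc l))))"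
    using stretch_step[OF l(1) p(1-3)] by blast
  have EB0: "1 + 1 / real_of_int (E * B) \<ge> 0" using E_pos B_pos by simp
  have "(1 + 1 / real_of_int (E * B)) ^ Suc k / L = (1 + 1 / real_of_int (E * B)) * ((1 + 1 / real_of_int (E * B)) ^ k / L)"
    by simp
  also have "\<dots> \<le> norm (F (shift i0 (u (Suc l)) q) - F q) / real_of_int (u (Suc l))"
    using mult_left_mono[OF p(4) EB0] q(4) by linarith
  finally show ?case using q(1-3) unfolding l(4) l_def[symmetric] by blast
qed

lemma levels_bounded:
  assumes "J > 0"
  shows "(1 + 1 / real_of_int (E * B)) ^ (J - 1) \<le> L\<^sup>2"
proof -
  obtain p where p: "node 0 p" "p \<in> int_box n" "shift i0 (u 1) p \<in> int_box n"
    "norm (F (shift i0 (u 1) p) - F p) / real_of_int (u 1) \<ge> (1 + 1 / real_of_int (E * B)) ^ (J - 1) / L"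
    using stretch_chain[of "J - 1"] assms by auto
  have u1: "real_of_int (u 1) > 0" using u_pos by simp
  have "node 0 (shift i0 (u 1) p)" using Bu_dvd_u[of 0 1] by (intro node_shift p) simp
  then have "norm (F (shift i0 (u 1) p) - F p) \<le> L * real_of_int (u 1)"
    using stretch_le[OF assms _ p(1) p(3,2)] u1 by (simp add: norm_shift)
  then have "norm (F (shift i0 (u 1) p) - F p) / real_of_int (u 1) \<le> L" using u1 by (simp add: field_simps)
  then have "(1 + 1 / real_of_int (E * B)) ^ (J - 1) / L \<le> L" using p(4) by linarith
  then show ?thesis using L by (simp add: pos_divide_le_eq power2_eq_square)
qed

end

section \<open>Patches that admit no bilipschitz bijection\<close>

text \<open>The inverse Lipschitz estimate is required for pairs with close images only, one of them in the cube:
  this is all that a homogeneous mapping provides for a patch far away from the origin.\<close>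
definition irregular_patch :: "'n::finite \<Rightarrow> real \<Rightarrow> int \<Rightarrow> (('n \<Rightarrow> int) \<Rightarrow> int) \<Rightarrow> bool" where
  "irregular_patch i0 L n W \<longleftrightarrow>
     n > 0 \<and> (\<forall>z. W z > 0 \<and> 2 * W z dvd n) \<and> (\<forall>z t. W (z(i0 := t)) = W z) \<and>
     \<not> (\<exists>G F :: ('n \<Rightarrow> int) \<Rightarrow> real ^ 'n.
       (\<forall>z\<in>int_box n. G z = patch_map i0 W z) \<and>
       (\<forall>z. (\<forall>i. 0 \<le> G z $ i \<and> G z $ i < real_of_int n) \<longrightarrow> z \<in> int_box n) \<and>
       bij_betw F UNIV integer_lattice \<and>
       (\<forall>z\<in>int_box n. \<forall>z'\<in>int_box n. norm (F z - F z') \<le> L * norm (G z - G z')) \<and>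
       (\<forall>z\<in>int_box n. \<forall>z'. norm (F z - F z') \<le> L * real CARD('n) * real_of_int n \<longrightarrow>
          norm (G z - G z') \<le> L * norm (F z - F z')))"

text \<open>This is a discrete form of the theorem of Burago and Kleiner and of McMullen that some densities bounded
  away from \<open>0\<close> and \<open>\<infinity>\<close> are not Jacobians of bilipschitz maps.\<close>
theorem irregular_patch_exists:
  fixes i0 :: "'n::finite" and L :: real
  assumes "CARD('n) \<ge> 2" and "L \<ge> 1"
  shows "\<exists>n W. irregular_patch i0 L n W"
proof -
  define d where "d = real CARD('n)"
  define E where "E = \<lceil>24 * d\<^sup>2 * (L\<^sup>2 + 1)\<rceil> + 1"
  define b where "b = 8 * L\<^sup>2 * (2 * d + 1) * real_of_int E ^ CARD('n) * (24 * d * L)\<^sup>2"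
  define B where "B = 2 * (\<bar>\<lceil>b\<rceil>\<bar> + 5)"
  define s where "s = 16 * int CARD('n) * (\<bar>\<lceil>24 * d\<^sup>2 * L\<rceil>\<bar> + 1)"
  have "24 * d\<^sup>2 * (L\<^sup>2 + 1) \<ge> 0" by simp
  then have E: "E > 0" "real_of_int E \<ge> 24 * d\<^sup>2 * (L\<^sup>2 + 1)" unfolding E_def by linarith+
  have B: "B \<ge> 10" "even B" by (auto simp: B_def)
  have "b \<le> real_of_int \<lceil>b\<rceil>" by (rule le_of_int_ceiling)
  also have "\<lceil>b\<rceil> \<le> B" by (simp add: B_def)
  finally have Bb: "real_of_int B \<ge> b" by simp
  have "1 * (\<bar>\<lceil>24 * d\<^sup>2 * L\<rceil>\<bar> + 1) \<le> 16 * int CARD('n) * (\<bar>\<lceil>24 * d\<^sup>2 * L\<rceil>\<bar> + 1)"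
    using assms(1) by (intro mult_right_mono) auto
  then have "\<bar>\<lceil>24 * d\<^sup>2 * L\<rceil>\<bar> + 1 \<le> s" by (simp add: s_def)
  then have s: "s > 0" and "\<lceil>24 * d\<^sup>2 * L\<rceil> \<le> s" by linarith+
  then have s': "real_of_int s \<ge> 24 * d\<^sup>2 * L" by (simp only: ceiling_le_iff)
  have s_dvd: "16 * int CARD('n) dvd s" by (simp add: s_def)
  have "1 + 1 / real_of_int (E * B) > 1" using E B by simp
  then obtain k where k: "L\<^sup>2 < (1 + 1 / real_of_int (E * B)) ^ k" using real_arch_pow by blast
  interpret strip_hierarchy i0 E B s using E B s by unfold_locales auto
  define J where "J = Suc k"
  have no_maps: "\<not> (\<exists>G F :: ('n \<Rightarrow> int) \<Rightarrow> real ^ 'n.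
       (\<forall>z\<in>int_box (2 * u J). G z = patch_map i0 (width J) z) \<and>
       (\<forall>z. (\<forall>i. 0 \<le> G z $ i \<and> G z $ i < real_of_int (2 * u J)) \<longrightarrow> z \<in> int_box (2 * u J)) \<and>
       bij_betw F UNIV integer_lattice \<and>
       (\<forall>z\<in>int_box (2 * u J). \<forall>z'\<in>int_box (2 * u J). norm (F z - F z') \<le> L * norm (G z - G z')) \<and>
       (\<forall>z\<in>int_box (2 * u J). \<forall>z'. norm (F z - F z') \<le> L * real CARD('n) * real_of_int (2 * u J) \<longrightarrow>
          norm (G z - G z') \<le> L * norm (F z - F z')))"
  proof (intro notI, elim exE conjE)
    fix G F :: "('n \<Rightarrow> int) \<Rightarrow> real ^ 'n"
    assume H: "\<forall>z\<in>int_box (2 * u J). G z = patch_map i0 (width J) z"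
      "\<forall>z. (\<forall>i. 0 \<le> G z $ i \<and> G z $ i < real_of_int (2 * u J)) \<longrightarrow> z \<in> int_box (2 * u J)"
      "bij_betw F UNIV integer_lattice"
      "\<forall>z\<in>int_box (2 * u J). \<forall>z'\<in>int_box (2 * u J). norm (F z - F z') \<le> L * norm (G z - G z')"
      "\<forall>z\<in>int_box (2 * u J). \<forall>z'. norm (F z - F z') \<le> L * real CARD('n) * real_of_int (2 * u J) \<longrightarrow>
         norm (G z - G z') \<le> L * norm (F z - F z')"
    interpret bilipschitz_patch i0 E B s J L d "2 * u J" G F
    proof unfold_locales
      show "real_of_int B \<ge> 8 * L\<^sup>2 * (2 * d + 1) * real_of_int E ^ CARD('n) * (24 * d * L)\<^sup>2"
        using Bb unfolding b_def .
      show "2 * u J = 2 * u J" ..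
      show "d = real CARD('n)" by (rule d_def)
      show "CARD('n) \<ge> 2" "L \<ge> 1" by fact+
      show "real_of_int E \<ge> 24 * d\<^sup>2 * (L\<^sup>2 + 1)" "B \<ge> 10" by fact+
      show "16 * int CARD('n) dvd s" "real_of_int s \<ge> 24 * d\<^sup>2 * L" by fact+
      show "bij_betw F UNIV integer_lattice" by fact
    next
      fix z z' :: "'n \<Rightarrow> int"
      show "G z = patch_map i0 (width J) z" if "z \<in> int_box (2 * u J)" using H(1) that by blast
      show "z \<in> int_box (2 * u J)" if "\<And>i. 0 \<le> G z $ i \<and> G z $ i < real_of_int (2 * u J)"
        using H(2) that by blast
      assume z: "z \<in> int_box (2 * u J)"
      show "norm (F z - F z') \<le> L * norm (G z - G z')" if "z' \<in> int_box (2 * u J)" using H(4) z that by blast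
      show "norm (G z - G z') \<le> L * norm (F z - F z')" if "norm (F z - F z') \<le> L * d * real_of_int (2 * u J)"
        using H(5) z that unfolding d_def by blast
    qed
    show False using levels_bounded k by (simp add: J_def)
  qed
  have "irregular_patch i0 L (2 * u J) (width J)"
    unfolding irregular_patch_def
  proof (intro conjI allI no_maps)
    show "2 * u J > 0" "width J z > 0" for z using u_pos width_pos by simp_all
    show "2 * width J z dvd 2 * u J" for z using width_dvd by simp
    show "width J (z(i0 := t)) = width J z" for z t by (rule width_indep)
  qed
  then show ?thesis by blast
qed

section \<open>Homogeneous mappings\<close>

lemma homogeneous_mappingI:
  assumes "f \<in> X \<rightarrow> Y" "K > 1" "a > 0" "{0<..<a} \<subseteq> I"
    and "\<And>R x y. R > 0 \<Longrightarrow> x \<in> X \<Longrightarrow> y \<in> X \<Longrightarrow> norm x \<le> R \<Longrightarrow> norm y \<le> R \<Longrightarrow> x \<noteq> y \<Longrightarrow>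
      norm (y - x) < a * R \<Longrightarrow> norm (f y - f x) \<le> K * R * \<omega> (norm (y - x) / R)"
  shows "homogeneous_mapping I \<omega> X Y f"
  unfolding homogeneous_mapping_def
proof (intro conjI)
  show "\<exists>K>1. \<exists>a>0. {0<..<a} \<subseteq> I \<and> (\<forall>R>0. \<forall>x\<in>X \<inter> cball 0 R. \<forall>y\<in>X \<inter> cball 0 R.
      x \<noteq> y \<and> norm (y - x) < a * R \<longrightarrow> norm (f y - f x) \<le> K * R * \<omega> (norm (y - x) / R))"
    using assms(2-5) by (intro exI[of _ K] conjI exI[of _ a] allI impI ballI) auto
qed (rule assms(1))

lemma homogeneous_mappingE:
  assumes "homogeneous_mapping I \<omega> X Y f"
  obtains K a where "K > 1" "a > 0" "{0<..<a} \<subseteq> I" "f \<in> X \<rightarrow> Y"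
    and "\<And>R x y. R > 0 \<Longrightarrow> x \<in> X \<Longrightarrow> y \<in> X \<Longrightarrow> norm x \<le> R \<Longrightarrow> norm y \<le> R \<Longrightarrow> x \<noteq> y \<Longrightarrow>
      norm (y - x) < a * R \<Longrightarrow> norm (f y - f x) \<le> K * R * \<omega> (norm (y - x) / R)"
proof -
  obtain K a where Ka: "K > 1" "a > 0" "{0<..<a} \<subseteq> I"
    and f: "\<forall>R>0. \<forall>x\<in>X \<inter> cball 0 R. \<forall>y\<in>X \<inter> cball 0 R.
      x \<noteq> y \<and> norm (y - x) < a * R \<longrightarrow> norm (f y - f x) \<le> K * R * \<omega> (norm (y - x) / R)"
    using assms unfolding homogeneous_mapping_def by blast
  show thesis
  proof (rule that[OF Ka])
    show "f \<in> X \<rightarrow> Y" using assms by (simp add: homogeneous_mapping_def)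
    show "norm (f y - f x) \<le> K * R * \<omega> (norm (y - x) / R)"
      if "R > 0" "x \<in> X" "y \<in> X" "norm x \<le> R" "norm y \<le> R" "x \<noteq> y" "norm (y - x) < a * R" for R x y
      using f that by simp
  qed
qed

text \<open>The constant \<open>a\<close> of a homogeneous mapping may be shrunk at will, so two moduli need to be
  compared on an initial interval only.\<close>

lemma regular_separated_net_weaken:
  fixes X :: "(real ^ 'n::finite) set"
  assumes reg: "regular_separated_net {0<..} \<omega> X" and C: "C \<ge> 1"
    and le: "\<And>t. 0 < t \<Longrightarrow> t < 1 \<Longrightarrow> \<omega> t \<le> C * \<omega>' t"
  shows "regular_separated_net {0<..} \<omega>' X"
proof -
  have "homogeneous_mapping {0<..} \<omega>' A B f" if hom: "homogeneous_mapping {0<..} \<omega> A B f"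
    for A B and f :: "real ^ 'n \<Rightarrow> real ^ 'n"
  proof -
    obtain K a where Ka: "K > 1" "a > 0" "f \<in> A \<rightarrow> B"
      and f: "\<And>R x y. R > 0 \<Longrightarrow> x \<in> A \<Longrightarrow> y \<in> A \<Longrightarrow> norm x \<le> R \<Longrightarrow> norm y \<le> R \<Longrightarrow> x \<noteq> y \<Longrightarrow>
        norm (y - x) < a * R \<Longrightarrow> norm (f y - f x) \<le> K * R * \<omega> (norm (y - x) / R)"
      using homogeneous_mappingE[OF hom] by metis
    show ?thesis
    proof (rule homogeneous_mappingI[of _ _ _ "K * C" "min a 1"])
      show "f \<in> A \<rightarrow> B" by fact
      have "1 * 1 < K * C" using Ka C by (intro mult_less_le_imp_less) auto
      then show "1 < K * C" by simp
      show "0 < min a 1" "{0<..<min a 1} \<subseteq> {0<..}" using Ka by auto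
    next
      fix R :: real and x y
      assume R: "0 < R" and xy: "x \<in> A" "y \<in> A" "norm x \<le> R" "norm y \<le> R" "x \<noteq> y"
        and less: "norm (y - x) < min a 1 * R"
      define t where "t = norm (y - x) / R"
      have "min a 1 * R \<le> a * R" "min a 1 * R \<le> 1 * R" using R by (intro mult_right_mono; simp)+
      then have lt: "norm (y - x) < a * R" "norm (y - x) < R" using less by linarith+
      then have "t < 1" "t > 0" using R xy by (auto simp: t_def)
      then have "\<omega> t \<le> C * \<omega>' t" by (intro le)
      then have "K * R * \<omega> t \<le> K * R * (C * \<omega>' t)" using Ka R by (intro mult_left_mono) auto
      then show "norm (f y - f x) \<le> K * C * R * \<omega>' (norm (y - x) / R)"
        using f[OF R xy lt(1)] by (simp add: t_def mult_ac)
    qed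
  qed
  then show ?thesis using reg unfolding regular_separated_net_def by blast
qed

section \<open>Integer lattices with sparse patches\<close>

text \<open>The \<open>k\<close>-th patch is the cube of side \<open>n k\<close> with its corner at distance \<open>\<rho> k\<close> from the origin on
  the positive axis \<open>i0\<close>. Inside it every fibre parallel to this axis is warped with the width
  prescribed by \<open>W k\<close>, outside all patches the integer lattice is left alone. As the side of a patch
  is a multiple of the period of each warp, the warps fit to the surrounding lattice.\<close>
locale patched_lattice =
  fixes i0 :: "'n::finite" and n \<rho> :: "nat \<Rightarrow> int" and W :: "nat \<Rightarrow> ('n \<Rightarrow> int) \<Rightarrow> int"
  assumes n_pos: "n k > 0" and W_pos: "W k z > 0" and W_dvd: "2 * W k z dvd n k"
    and W_indep: "W k (z(i0 := t)) = W k z"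
    and rho_pos: "\<rho> 0 > 0" and gap: "\<rho> k + n k < \<rho> (Suc k)"
begin

definition in_patch :: "nat \<Rightarrow> ('n \<Rightarrow> int) \<Rightarrow> bool" where
  "in_patch k z \<longleftrightarrow> \<rho> k \<le> z i0 \<and> z i0 < \<rho> k + n k \<and> (\<forall>i. i \<noteq> i0 \<longrightarrow> 0 \<le> z i \<and> z i < n k)"

text \<open>The description operator picks the only patch containing the point; patches are disjoint by the
  assumption on the gaps.\<close>
definition coord :: "('n \<Rightarrow> int) \<Rightarrow> real" where
  "coord z = (if \<exists>k. in_patch k z
     then let k = (THE k. in_patch k z) in real_of_int (\<rho> k) + warp (W k z) (z i0 - \<rho> k)
     else real_of_int (z i0))"

definition emb :: "('n \<Rightarrow> int) \<Rightarrow> real ^ 'n" where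
  "emb z = (\<chi> i. if i = i0 then coord z else real_of_int (z i))"

lemma rho_gap: "k < k' \<Longrightarrow> \<rho> k + n k < \<rho> k'"
proof (induction k')
  case (Suc k')
  then show ?case using gap[of k'] gap[of k] n_pos[of k'] by (cases "k = k'") auto
qed simp

lemma rho_ge: "\<rho> k > 0"
  using rho_pos rho_gap[of 0 k] n_pos[of 0] by (cases k) auto

lemma intervals_disjoint:
  assumes "\<rho> k \<le> s" "s \<le> \<rho> k + n k" "\<rho> k' \<le> s" "s \<le> \<rho> k' + n k'"
  shows "k = k'"
  using assms rho_gap[of k k'] rho_gap[of k' k] by (cases k k' rule: linorder_cases) auto

lemma in_patch_unique: "in_patch k z \<Longrightarrow> in_patch k' z \<Longrightarrow> k = k'"
  by (rule intervals_disjoint[of _ "z i0"]) (auto simp: in_patch_def)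

lemma coord_in_patch: "in_patch k z \<Longrightarrow> coord z = real_of_int (\<rho> k) + warp (W k z) (z i0 - \<rho> k)"
proof -
  assume k: "in_patch k z"
  then have "(THE k. in_patch k z) = k" using in_patch_unique by blast
  then show ?thesis using k by (auto simp: coord_def Let_def)
qed

lemma coord_outside: "(\<And>k. \<not> in_patch k z) \<Longrightarrow> coord z = real_of_int (z i0)"
  by (simp add: coord_def)

lemma coord_bounds:
  assumes "in_patch k z"
  shows "real_of_int (\<rho> k) \<le> coord z" "coord z < real_of_int (\<rho> k) + real_of_int (n k)"
proof -
  let ?s = "z i0 - \<rho> k"
  have "0 \<le> ?s" "?s < n k" using assms by (auto simp: in_patch_def)
  then have "0 \<le> warp (W k z) ?s" "warp (W k z) ?s < real_of_int (n k)"
    using warp_ge_iff[OF W_pos, of k z 0 ?s] warp_ge_iff[OF W_pos W_dvd, of k z ?s] by auto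
  then show "real_of_int (\<rho> k) \<le> coord z" "coord z < real_of_int (\<rho> k) + real_of_int (n k)"
    unfolding coord_in_patch[OF assms] by auto
qed

text \<open>Only the boundaries of patches need care. At the left boundary the warp starts with the identity; the
  first point to the right of a patch is still given by the formula of the warp.\<close>
lemma coord_step:
  shows "2 / 3 \<le> coord (z(i0 := s + 1)) - coord (z(i0 := s))"
    and "coord (z(i0 := s + 1)) - coord (z(i0 := s)) \<le> 2"
proof -
  let ?z = "z(i0 := s)" and ?z' = "z(i0 := s + 1)"
  have "2 / 3 \<le> coord ?z' - coord ?z \<and> coord ?z' - coord ?z \<le> 2"
  proof (cases "\<exists>k. in_patch k ?z")
    case True
    then obtain k where k: "in_patch k ?z" by blast
    have "coord ?z' = real_of_int (\<rho> k) + warp (W k z) ((s - \<rho> k) + 1)"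
    proof (cases "in_patch k ?z'")
      case True
      then show ?thesis using coord_in_patch[OF True] W_indep[of k z] by (simp add: algebra_simps)
    next
      case False
      then have s: "s + 1 = \<rho> k + n k" using k by (auto simp: in_patch_def)
      have "\<not> in_patch k' ?z'" for k'
      proof
        assume k': "in_patch k' ?z'"
        then have "k = k'" using s n_pos[of k] by (intro intervals_disjoint[of _ "s + 1"]) (auto simp: in_patch_def)
        then show False using k' False by simp
      qed
      then have "coord ?z' = real_of_int (s + 1)" using coord_outside[of ?z'] by simp
      moreover have e: "(s - \<rho> k) + 1 = n k" using s by simp
      ultimately show ?thesis unfolding e using warp_fixed[OF W_pos W_dvd, of k z] s by simp
    qed
    moreover have "coord ?z = real_of_int (\<rho> k) + warp (W k z) (s - \<rho> k)"
      using coord_in_patch[OF k] W_indep[of k z] by simp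
    ultimately show ?thesis using warp_step[OF W_pos, of k z "s - \<rho> k"] by simp
  next
    case False
    then have c: "coord ?z = real_of_int s" using coord_outside[of ?z] by simp
    show ?thesis
    proof (cases "\<exists>k. in_patch k ?z'")
      case True
      then obtain k where k: "in_patch k ?z'" by blast
      have "\<not> \<rho> k \<le> s"
      proof
        assume "\<rho> k \<le> s"
        then have "in_patch k ?z" using k by (auto simp: in_patch_def)
        then show False using False by blast
      qed
      then have "s + 1 = \<rho> k" using k by (auto simp: in_patch_def)
      then have "coord ?z' = real_of_int (s + 1)"
        using coord_in_patch[OF k] warp_fixed[OF W_pos, of k ?z' 0] by simp
      then show ?thesis using c by simp
    next
      case False
      then show ?thesis using c coord_outside[of ?z'] by simp
    qed
  qed
  then show "2 / 3 \<le> coord ?z' - coord ?z" "coord ?z' - coord ?z \<le> 2" by auto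
qed

lemma coord_expanding:
  assumes "s \<le> s'"
  shows "2 / 3 * real_of_int (s' - s) \<le> coord (z(i0 := s')) - coord (z(i0 := s))"
  using assms
proof (induction s' rule: int_ge_induct)
  case (step s')
  have "2 / 3 * real_of_int (s' + 1 - s) = 2 / 3 * real_of_int (s' - s) + 2 / 3" by simp
  then show ?case using step coord_step(1)[of z s'] by linarith
qed simp

lemma emb_separated:
  assumes "z \<noteq> z'"
  shows "norm (emb z - emb z') \<ge> 2 / 3"
proof (cases "\<exists>i. i \<noteq> i0 \<and> z i \<noteq> z' i")
  case True
  then obtain i where i: "i \<noteq> i0" "z i \<noteq> z' i" by blast
  then have "\<bar>real_of_int (z i) - real_of_int (z' i)\<bar> \<ge> 1" by linarith
  then show ?thesis using component_le_norm_cart[of "emb z - emb z'" i] i by (simp add: emb_def)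
next
  case False
  then have z': "z' = z(i0 := z' i0)" by (auto simp: fun_eq_iff)
  have "z i0 \<noteq> z' i0"
  proof
    assume "z i0 = z' i0"
    then have "z = z'" using False by (auto simp: fun_eq_iff)
    then show False using assms by simp
  qed
  have *: "\<bar>coord (z(i0 := s')) - coord (z(i0 := s))\<bar> \<ge> 2 / 3" if "s < s'" for s s'
  proof -
    have "real_of_int (s' - s) \<ge> 1" using that by linarith
    then show ?thesis using coord_expanding[of s s' z] that by (simp add: abs_le_iff)
  qed
  have "\<bar>coord z - coord z'\<bar> \<ge> 2 / 3"
    using *[of "z i0" "z' i0"] *[of "z' i0" "z i0"] \<open>z i0 \<noteq> z' i0\<close> z'
    by (cases "z i0 < z' i0") (auto simp: abs_minus_commute simp del: fun_upd_apply)
  then show ?thesis using component_le_norm_cart[of "emb z - emb z'" i0] by (simp add: emb_def)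
qed

lemma inj_emb: "inj emb"
proof (rule injI, rule ccontr)
  fix z z' assume "emb z = emb z'" "z \<noteq> z'"
  then show False using emb_separated[of z z'] by simp
qed

lemma emb_dense: "\<exists>z. norm (emb z - x) \<le> real CARD('n) * 2"
proof -
  define z where "z i = \<lfloor>x $ i\<rfloor>" for i
  define H where "H s = coord (z(i0 := s))" for s
  have H: "2 / 3 * real_of_int (s' - s) \<le> H s' - H s" if "s \<le> s'" for s s'
    using coord_expanding[OF that] by (simp add: H_def)
  define M where "M = 2 * \<lceil>\<bar>x $ i0 - H 0\<bar>\<rceil> + 2"
  have M_pos: "M \<ge> 0" by (simp add: M_def)
  have "\<bar>x $ i0 - H 0\<bar> \<le> real_of_int \<lceil>\<bar>x $ i0 - H 0\<bar>\<rceil>" by (rule le_of_int_ceiling)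
  moreover have "real_of_int M = 2 * real_of_int \<lceil>\<bar>x $ i0 - H 0\<bar>\<rceil> + 2" by (simp add: M_def)
  moreover have "0 \<le> \<bar>x $ i0 - H 0\<bar>" by simp
  ultimately have M: "2 / 3 * real_of_int M > \<bar>x $ i0 - H 0\<bar>" by argo
  have "2 / 3 * real_of_int M \<le> H 0 - H (- M)" using H[of "- M" 0] M_pos by simp
  then have lo: "H (- M) \<le> x $ i0" using M by linarith
  have "2 / 3 * real_of_int M \<le> H M - H 0" using H[of 0 M] M_pos by simp
  then have "x $ i0 < H M" using M by linarith
  moreover have "- M + int (nat (2 * M)) = M" using M_pos by simp
  ultimately have hi: "x $ i0 < H (- M + int (nat (2 * M)))" by (simp only:)
  define m where "m = (LEAST m. x $ i0 < H (- M + int m))"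
  have m: "x $ i0 < H (- M + int m)" unfolding m_def by (rule LeastI[of "\<lambda>m. x $ i0 < H (- M + int m)", OF hi])
  then obtain m' where m': "m = Suc m'" using lo by (cases m) auto
  then have "m' < m" by simp
  then have "\<not> x $ i0 < H (- M + int m')" unfolding m_def by (rule not_less_Least)
  moreover define s where "s = - M + int m'"
  moreover have "s + 1 = - M + int m" using m' by (simp add: s_def)
  ultimately have s: "H s \<le> x $ i0" "x $ i0 < H (s + 1)" using m by (simp_all only: not_less)
  have "norm (emb (z(i0 := s)) - x) \<le> real CARD('n) * 2"
  proof (rule norm_le_card_mult)
    fix i
    have "\<bar>real_of_int (z i) - x $ i\<bar> \<le> 2" unfolding z_def by linarith
    moreover have "\<bar>H s - x $ i0\<bar> \<le> 2" using s coord_step(2)[of z s] by (auto simp: H_def)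
    ultimately show "\<bar>(emb (z(i0 := s)) - x) $ i\<bar> \<le> 2" by (auto simp: emb_def H_def)
  qed
  then show ?thesis by blast
qed

lemma separated_net_range_emb: "separated_net (range emb)"
  unfolding separated_net_def
proof
  have "ereal (2 / 3) \<le> Inf {ereal (norm (z - z')) |z z'. z \<in> range emb \<and> z' \<in> range emb \<and> z \<noteq> z'}"
  proof (rule Inf_greatest)
    fix e assume "e \<in> {ereal (norm (z - z')) |z z'. z \<in> range emb \<and> z' \<in> range emb \<and> z \<noteq> z'}"
    then obtain z z' where "e = ereal (norm (emb z - emb z'))" "z \<noteq> z'" by blast
    then show "ereal (2 / 3) \<le> e" using emb_separated[OF \<open>z \<noteq> z'\<close>] by (simp only: ereal_less_eq)
  qed
  then show "separated (range emb)" unfolding separated_def by (rule less_le_trans[rotated]) simp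
next
  have "(SUP x. INF z\<in>range emb. ereal (norm (z - x))) \<le> ereal (real CARD('n) * 2)"
  proof (rule SUP_least)
    fix x :: "real ^ 'n"
    obtain z where "norm (emb z - x) \<le> real CARD('n) * 2" using emb_dense by blast
    then show "(INF z\<in>range emb. ereal (norm (z - x))) \<le> ereal (real CARD('n) * 2)"
      by (intro INF_lower2[of "emb z"]) auto
  qed
  also have "\<dots> < \<infinity>" by simp
  finally show "net (range emb)" unfolding net_def .
qed

lemma emb_displacement:
  assumes "in_patch k z"
  shows "norm (emb z - lattice_point z) \<le> real_of_int (n k)"
    and "real_of_int (\<rho> k) \<le> norm (emb z)" and "real_of_int (\<rho> k) \<le> norm (lattice_point z :: real ^ 'n)"
proof -
  have z: "real_of_int (\<rho> k) \<le> real_of_int (z i0)" "real_of_int (z i0) < real_of_int (\<rho> k) + real_of_int (n k)"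
    using assms by (auto simp: in_patch_def)
  have "emb z - lattice_point z = axis i0 (coord z - real_of_int (z i0))"
    by (auto simp: vec_eq_iff emb_def axis_def)
  then have "norm (emb z - lattice_point z) = \<bar>coord z - real_of_int (z i0)\<bar>"
    by (simp add: norm_eq_sqrt_inner inner_axis_axis)
  then show "norm (emb z - lattice_point z) \<le> real_of_int (n k)"
    using coord_bounds[OF assms] z by (simp add: abs_le_iff)
  show "real_of_int (\<rho> k) \<le> norm (emb z)"
    using coord_bounds[OF assms] component_le_norm_cart[of "emb z" i0] by (simp add: emb_def)
  show "real_of_int (\<rho> k) \<le> norm (lattice_point z :: real ^ 'n)"
    using z component_le_norm_cart[of "lattice_point z :: real ^ 'n" i0] by simp
qed

lemma emb_outside: "(\<And>k. \<not> in_patch k z) \<Longrightarrow> emb z = lattice_point z"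
  by (simp add: vec_eq_iff emb_def coord_outside)

text \<open>The obvious bijection from the net to the integer lattice moves the points of the \<open>k\<close>-th patch by at most
  \<open>n k\<close> and the points outside of all patches not at all. The allowed distance \<open>R * \<omega> (s / R)\<close> increases with both
  \<open>R\<close> and \<open>s\<close>, where \<open>R \<ge> \<rho> k\<close> for points of this patch and \<open>s \<ge> 2/3\<close> for any two points. So it
  suffices that the displacement is allowed for \<open>R = \<rho> k\<close> and \<open>s = 2/3\<close>.\<close>
lemma regular_range_emb:
  assumes mono: "strict_mono_on {0<..} \<omega>"
    and ratio: "\<And>t t'. 0 < t' \<Longrightarrow> t' \<le> t \<Longrightarrow> \<omega> t * t' \<le> \<omega> t' * t"
    and ge: "\<And>t. 0 < t \<Longrightarrow> t \<le> 1 \<Longrightarrow> t \<le> \<omega> t"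
    and patch: "\<And>k. real_of_int (n k) \<le> real_of_int (\<rho> k) * \<omega> ((2 / 3) / real_of_int (\<rho> k))"
  shows "regular_separated_net {0<..} \<omega> (range emb)"
proof -
  have disp: "norm (emb z - lattice_point z) \<le> R * \<omega> (s / R)"
    if R: "R > 0" and s: "s \<ge> 2 / 3" "s < R" and z: "norm (emb z) \<le> R \<or> norm (lattice_point z :: real ^ 'n) \<le> R" for R s z
  proof (cases "\<exists>k. in_patch k z")
    case True
    then obtain k where k: "in_patch k z" by blast
    have rk: "real_of_int (\<rho> k) > 0" "real_of_int (\<rho> k) \<le> R" using emb_displacement[OF k] z rho_ge[of k] by auto
    define t where "t = (2 / 3) / real_of_int (\<rho> k)"
    define t' where "t' = (2 / 3) / R"
    have "\<omega> t * t' \<le> \<omega> t' * t" using rk R by (intro ratio) (auto simp: t_def t'_def field_simps)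
    then have "real_of_int (\<rho> k) * \<omega> t \<le> R * \<omega> t'"
      using rk R by (simp add: t_def t'_def field_simps)
    moreover have "\<omega> t' \<le> \<omega> (s / R)"
    proof (cases "s = 2 / 3")
      case True
      then show ?thesis unfolding t'_def by (simp only:)
    next
      case False
      then have "2 / 3 < s" using s by linarith
      then have "t' < s / R" unfolding t'_def using R by (rule divide_strict_right_mono)
      moreover have "t' > 0" using R by (simp add: t'_def)
      ultimately show ?thesis using mono R s by (intro less_imp_le) (auto simp: strict_mono_on_def)
    qed
    then have "R * \<omega> t' \<le> R * \<omega> (s / R)" using R by simp
    ultimately show ?thesis using patch[of k] emb_displacement(1)[OF k] by (simp add: t_def)
  next
    case False
    have "0 \<le> s / R" using s R by simp
    also have "\<dots> \<le> \<omega> (s / R)" using s R by (intro ge) auto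
    finally show ?thesis using False R by (simp add: emb_outside)
  qed
  have le: "s \<le> R * \<omega> (s / R)" if "R > 0" "s \<ge> 2 / 3" "s < R" for R s
  proof -
    have "s / R \<le> \<omega> (s / R)" using that by (intro ge) auto
    then show ?thesis using that by (simp add: field_simps)
  qed
  define f where "f x = (lattice_point (inv emb x) :: real ^ 'n)" for x
  have f_emb: "f (emb z) = lattice_point z" for z by (simp add: f_def inv_f_f[OF inj_emb])
  have inj_lat: "inj (lattice_point :: ('n \<Rightarrow> int) \<Rightarrow> real ^ 'n)"
    by (auto simp: inj_def vec_eq_iff fun_eq_iff)
  have bij: "bij_betw f (range emb) integer_lattice"
    unfolding bij_betw_def
  proof
    show "inj_on f (range emb)"
      using inj_lat by (auto simp: inj_on_def f_emb)
    show "f ` range emb = integer_lattice"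
      unfolding range_lattice_point[symmetric] by (auto simp: f_emb image_image)
  qed
  have inv_f: "inv_into (range emb) f (lattice_point z) = emb z" for z
    using inv_into_f_f[of f "range emb" "emb z"] bij by (simp add: f_emb bij_betw_def)
  have "homogeneous_mapping {0<..} \<omega> (range emb) integer_lattice f"
  proof (rule homogeneous_mappingI[of _ _ _ 3 1])
    show "f \<in> range emb \<rightarrow> integer_lattice" using bij by (auto simp: bij_betw_def)
  next
    fix R :: real and x y
    assume R: "0 < R" and x: "x \<in> range emb" "norm x \<le> R" and y: "y \<in> range emb" "norm y \<le> R"
      and xy: "x \<noteq> y" "norm (y - x) < 1 * R"
    obtain z z' where z: "x = emb z" "y = emb z'" using x y by auto
    have s: "norm (y - x) \<ge> 2 / 3" using emb_separated[of z' z] xy z by auto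
    have "f y - f x = (y - x) - (emb z' - lattice_point z') + (emb z - lattice_point z)"
      by (simp add: z f_emb)
    then have "norm (f y - f x) \<le> norm (y - x) + norm (emb z' - lattice_point z') + norm (emb z - lattice_point z)"
      by (simp only: norm_triangle3)
    then show "norm (f y - f x) \<le> 3 * R * \<omega> (norm (y - x) / R)"
      using disp[OF R s, of z] disp[OF R s, of z'] le[OF R s] xy x y z by (simp add: dist_norm)
  qed auto
  moreover have "homogeneous_mapping {0<..} \<omega> integer_lattice (range emb) (inv_into (range emb) f)"
  proof (rule homogeneous_mappingI[of _ _ _ 3 1])
    show "inv_into (range emb) f \<in> integer_lattice \<rightarrow> range emb"
      unfolding range_lattice_point[symmetric] by (auto simp: inv_f)
  next
    fix R :: real and x y :: "real ^ 'n"
    assume R: "0 < R" and x: "x \<in> integer_lattice" "norm x \<le> R" and y: "y \<in> integer_lattice" "norm y \<le> R"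
      and xy: "x \<noteq> y" "norm (y - x) < 1 * R"
    obtain z z' where z: "x = lattice_point z" "y = lattice_point z'"
      using x y unfolding range_lattice_point[symmetric] by auto
    then obtain i where "z i \<noteq> z' i" using xy by (auto simp: vec_eq_iff)
    then have "\<bar>real_of_int (z' i) - real_of_int (z i)\<bar> \<ge> 1" by linarith
    then have s: "norm (y - x) \<ge> 2 / 3" using component_le_norm_cart[of "y - x" i] z by simp
    have "emb z' - emb z = (y - x) - (lattice_point z' - emb z') + (lattice_point z - emb z)"
      by (simp add: z)
    then have "norm (emb z' - emb z) \<le> norm (y - x) + norm (lattice_point z' - emb z') + norm (lattice_point z - emb z)"
      by (simp only: norm_triangle3)
    then show "norm (inv_into (range emb) f y - inv_into (range emb) f x) \<le> 3 * R * \<omega> (norm (y - x) / R)"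
      using disp[OF R s, of z] disp[OF R s, of z'] le[OF R s] xy x y z
      by (simp add: inv_f dist_norm norm_minus_commute)
  qed auto
  ultimately show ?thesis unfolding regular_separated_net_def using separated_net_range_emb bij by blast
qed

text \<open>At distance about \<open>\<rho> k\<close> from the origin, a homogeneous mapping with such a modulus is Lipschitz
  with a constant that grows only linearly with \<open>k\<close>, because the summand \<open>1 / \<rho> k\<close> contributes a bounded
  distance. For large \<open>k\<close> this constant is smaller than \<open>(k + 1)\<^sup>2\<close>, which the \<open>k\<close>-th patch rules out. The images
  of points of the patch have norm at most \<open>C * \<rho> k\<close> with \<open>C\<close> independent of \<open>k\<close>, so the same estimate
  holds for the inverse mapping.\<close>
lemma irregular_range_emb:
  assumes irr: "\<And>k. irregular_patch i0 ((real k + 1)\<^sup>2) (n k) (W k)"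
    and sparse: "\<And>k. real CARD('n) * real_of_int (n k) * (real k + 1) ^ 3 \<le> real_of_int (\<rho> k)"
    and \<omega>: "\<And>t k. t > 0 \<Longrightarrow> \<omega> t \<le> (real k + 1) * t + 1 / real_of_int (\<rho> k)"
  shows "\<not> regular_separated_net {0<..} \<omega> (range emb)"
proof
  let ?X = "range emb" and ?D = "real CARD('n)"
  assume "regular_separated_net {0<..} \<omega> ?X"
  then obtain f where bij: "bij_betw f ?X integer_lattice"
    and hf: "homogeneous_mapping {0<..} \<omega> ?X integer_lattice f"
    and hg: "homogeneous_mapping {0<..} \<omega> integer_lattice ?X (inv_into ?X f)"
    by (auto simp: regular_separated_net_def)
  obtain K1 a1 where K1: "K1 > 1" "a1 > 0"
    and f1: "\<And>R x y. R > 0 \<Longrightarrow> x \<in> ?X \<Longrightarrow> y \<in> ?X \<Longrightarrow> norm x \<le> R \<Longrightarrow> norm y \<le> R \<Longrightarrow> x \<noteq> y \<Longrightarrow>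
      norm (y - x) < a1 * R \<Longrightarrow> norm (f y - f x) \<le> K1 * R * \<omega> (norm (y - x) / R)"
    using homogeneous_mappingE[OF hf] by metis
  obtain K2 a2 where K2: "K2 > 1" "a2 > 0"
    and f2: "\<And>R x y. R > 0 \<Longrightarrow> x \<in> integer_lattice \<Longrightarrow> y \<in> integer_lattice \<Longrightarrow> norm x \<le> R \<Longrightarrow> norm y \<le> R \<Longrightarrow> x \<noteq> y \<Longrightarrow>
      norm (y - x) < a2 * R \<Longrightarrow> norm (inv_into ?X f y - inv_into ?X f x) \<le> K2 * R * \<omega> (norm (y - x) / R)"
    using homogeneous_mappingE[OF hg] by metis
  define K where "K = max K1 K2"
  define a where "a = min 1 (min a1 a2)"
  have K: "K > 1" "K1 \<le> K" "K2 \<le> K" using K1 by (auto simp: K_def)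
  have a: "a > 0" "a \<le> 1" "a \<le> a1" "a \<le> a2" using K1 K2 by (auto simp: a_def)
  define C where "C = norm (f 0) + 6 * K / a"
  have C: "C \<ge> 1"
  proof -
    have "1 \<le> 6 * K / a" using K a by (simp add: field_simps)
    then show ?thesis unfolding C_def by (smt (verit) norm_ge_zero)
  qed
  obtain k :: nat where k: "real k \<ge> K * (2 * C + 4)" "real k > 1 / a"
    using reals_Archimedean2[of "max (K * (2 * C + 4)) (1 / a)"] by (auto intro: less_imp_le)
  define m where "m = real k + 1"
  define r where "r = real_of_int (\<rho> k)"
  define N where "N = real_of_int (n k)"
  have m: "m \<ge> 1" "m > 0" by (auto simp: m_def)
  have r: "r \<ge> 1" using rho_ge[of k] unfolding r_def by linarith
  have N: "N > 0" using n_pos by (simp add: N_def)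
  have D: "?D \<ge> 1" by (simp add: Suc_le_eq)
  have am: "1 / m < a"
  proof -
    have "1 / a < m" using k(2) by (simp add: m_def)
    then show ?thesis using a(1) m by (simp add: field_simps)
  qed
  have sp: "m\<^sup>2 * ?D * N \<le> r / m"
  proof -
    have "?D * N * m ^ 3 \<le> r" using sparse[of k] unfolding m_def N_def r_def .
    then have "m\<^sup>2 * ?D * N * m \<le> r" by (simp add: power2_eq_square power3_eq_cube mult_ac)
    then show ?thesis using m by (simp only: pos_le_divide_eq)
  qed
  have DN: "?D * N \<le> r / m"
  proof -
    have "1 * (?D * N) \<le> m\<^sup>2 * (?D * N)" using m N D by (intro mult_right_mono) (auto simp: one_le_power)
    then show ?thesis using sp unfolding mult.assoc by linarith
  qed
  have rm: "r / m < a * r" "r / m \<le> r"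
  proof -
    have "(1 / m) * r < a * r" using am r by (intro mult_strict_right_mono) auto
    then show "r / m < a * r" by simp
    have "(1 / m) * r \<le> 1 * r" using m r by (intro mult_right_mono) auto
    then show "r / m \<le> r" by simp
  qed
  have m2: "K * (m + 2 * C + 3) \<le> m\<^sup>2"
  proof -
    have "K * (2 * C + 3) * 1 \<le> K * (2 * C + 3) * m" using K C m by (intro mult_left_mono) auto
    then have "K * (m + 2 * C + 3) \<le> K * (2 * C + 4) * m" by (simp add: algebra_simps)
    also have "\<dots> \<le> m * m" using k m by (intro mult_right_mono) (auto simp: m_def)
    finally show ?thesis by (simp add: power2_eq_square)
  qed
  have \<omega>k: "K' * R * \<omega> (s / R) \<le> K * (m * s + R / r)" if "0 < K'" "K' \<le> K" "R > 0" "s > 0" for K' R s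
  proof -
    have "\<omega> (s / R) \<le> m * (s / R) + 1 / r" using \<omega>[of "s / R" k] that by (simp add: m_def r_def)
    then have "K' * R * \<omega> (s / R) \<le> K' * R * (m * (s / R) + 1 / r)" using that by (intro mult_left_mono) auto
    also have "\<dots> = K' * (m * s + R / r)" using that by (simp add: field_simps)
    also have "\<dots> \<le> K * (m * s + R / r)" using that m r by (intro mult_right_mono) auto
    finally show ?thesis .
  qed
  define sh where "sh z = z(i0 := z i0 + \<rho> k)" for z :: "'n \<Rightarrow> int"
  define G where "G z = emb (sh z) - axis i0 r" for z
  define F where "F z = f (emb (sh z))" for z
  have G_diff: "G z - G z' = emb (sh z) - emb (sh z')" for z z' by (simp add: G_def)
  have W_sh: "W k (sh z) = W k z" for z unfolding sh_def by (rule W_indep)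
  have sh_inj: "inj sh"
  proof (rule injI)
    fix z z' :: "'n \<Rightarrow> int" assume eq: "sh z = sh z'"
    have "z i = z' i" for i using fun_cong[OF eq, of i] by (auto simp: sh_def split: if_splits)
    then show "z = z'" by auto
  qed
  have sh_surj: "surj sh"
  proof (rule surjI)
    show "sh (z(i0 := z i0 - \<rho> k)) = z" for z :: "'n \<Rightarrow> int" by (simp add: sh_def)
  qed
  have bij_F: "bij_betw F UNIV integer_lattice"
  proof -
    have "bij_betw (emb \<circ> sh) UNIV (range emb)"
      using inj_emb sh_inj sh_surj by (auto simp: bij_betw_def intro: inj_compose) (metis rangeI surjD)
    then have "bij_betw (f \<circ> (emb \<circ> sh)) UNIV integer_lattice" using bij by (rule bij_betw_trans)
    then show ?thesis by (simp add: F_def[abs_def] comp_def)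
  qed
  have F_lat: "F z \<in> integer_lattice" for z using bij_F by (auto simp: bij_betw_def)
  have inv_F: "inv_into ?X f (F z) = emb (sh z)" for z
    unfolding F_def using bij by (intro inv_into_f_f) (auto simp: bij_betw_def)
  have patch: "in_patch k (sh z)" if "z \<in> int_box (n k)" for z
    using that by (auto simp: in_patch_def int_box_def sh_def)
  have G_patch: "G z = patch_map i0 (W k) z" if "z \<in> int_box (n k)" for z
    using coord_in_patch[OF patch[OF that]] W_sh[of z]
    by (auto simp: vec_eq_iff G_def emb_def patch_map_def axis_def r_def sh_def)
  have G_nonneg: "0 \<le> G z $ i \<and> G z $ i < N" if "z \<in> int_box (n k)" for z i
  proof (cases "i = i0")
    case True
    then show ?thesis using coord_bounds[OF patch[OF that]] by (simp add: G_def emb_def axis_def r_def N_def)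
  next
    case False
    then show ?thesis using that by (auto simp: G_def emb_def axis_def N_def int_box_def sh_def)
  qed
  have G_box: "z \<in> int_box (n k)" if "\<forall>i. 0 \<le> G z $ i \<and> G z $ i < real_of_int (n k)" for z
  proof -
    have zi: "0 \<le> z i \<and> z i < n k" if "i \<noteq> i0" for i
      using spec[OF \<open>\<forall>i. _ i\<close>, of i] that by (simp add: G_def emb_def axis_def sh_def)
    have c: "r \<le> coord (sh z)" "coord (sh z) < r + N"
      using spec[OF that, of i0] by (auto simp: G_def emb_def axis_def N_def)
    have "0 \<le> z i0 \<and> z i0 < n k"
    proof (cases "\<exists>k'. in_patch k' (sh z)")
      case True
      then obtain k' where k': "in_patch k' (sh z)" by blast
      have "k' = k"
      proof (rule ccontr)
        assume "k' \<noteq> k"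
        then have "\<rho> k + n k < \<rho> k' \<or> \<rho> k' + n k' < \<rho> k" using rho_gap by (meson linorder_neqE_nat)
        then have "r + N < real_of_int (\<rho> k') \<or> real_of_int (\<rho> k') + real_of_int (n k') < r"
          unfolding r_def N_def by linarith
        then show False using c coord_bounds[OF k'] by linarith
      qed
      then show ?thesis using k' by (auto simp: in_patch_def sh_def)
    next
      case False
      then show ?thesis using c coord_outside[of "sh z"] by (auto simp: sh_def r_def N_def)
    qed
    then show ?thesis using zi by (auto simp: int_box_def) metis+
  qed
  have diam: "norm (G z - G z') \<le> ?D * N" if "z \<in> int_box (n k)" "z' \<in> int_box (n k)" for z z'
  proof (rule norm_le_card_mult)
    show "\<bar>(G z - G z') $ i\<bar> \<le> N" for i
      using G_nonneg[OF that(1), of i] G_nonneg[OF that(2), of i] by (simp add: abs_le_iff)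
  qed
  have nx: "norm (emb (sh z)) \<le> 2 * r" if "z \<in> int_box (n k)" for z
  proof -
    have "norm (G z) \<le> ?D * N"
    proof (rule norm_le_card_mult)
      show "\<bar>G z $ i\<bar> \<le> N" for i using G_nonneg[OF that, of i] by simp
    qed
    moreover have "norm (axis i0 r :: real ^ 'n) = r" using r by (simp add: norm_eq_sqrt_inner inner_axis_axis)
    moreover have "emb (sh z) = G z + axis i0 r" by (simp add: G_def)
    ultimately show ?thesis using norm_triangle_ineq[of "G z" "axis i0 r"] DN rm by simp
  qed
  have "emb (\<lambda>_. 0) = 0"
  proof -
    have "\<not> in_patch k' (\<lambda>_. 0)" for k' using rho_ge[of k'] by (simp add: in_patch_def)
    then show ?thesis using emb_outside[of "\<lambda>_. 0"] by (simp add: vec_eq_iff)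
  qed
  then have zero: "0 \<in> ?X" by (metis rangeI)
  have nF: "norm (F z) \<le> C * r" if z: "z \<in> int_box (n k)" for z
  proof -
    define x where "x = emb (sh z)"
    have x_pos: "norm x > 0" using emb_displacement(2)[OF patch[OF z]] rho_ge[of k] by (auto simp: x_def)
    \<comment> \<open>A radius large enough for the origin and \<open>x\<close> to count as close to each other.\<close>
    define R where "R = 3 * r / a"
    have R: "R > 0" "norm x \<le> R" "norm (x - 0) < a1 * R"
    proof -
      show "R > 0" using r a by (simp add: R_def)
      have "norm x \<le> 2 * r" using nx[OF z] by (simp add: x_def)
      moreover have aR: "a * R = 3 * r" using a by (simp add: R_def)
      moreover have "a * R \<le> a1 * R" using a \<open>R > 0\<close> by (intro mult_right_mono) auto
      ultimately show "norm (x - 0) < a1 * R" using r by simp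
      have "a * R \<le> 1 * R" using a \<open>R > 0\<close> by (intro mult_right_mono) auto
      then show "norm x \<le> R" using \<open>norm x \<le> 2 * r\<close> aR r by simp
    qed
    have "norm (f x - f 0) \<le> K1 * R * \<omega> (norm (x - 0) / R)"
    proof (rule f1[OF R(1) zero _ _ R(2) _ R(3)])
      show "x \<in> ?X" "norm (0 :: real ^ 'n) \<le> R" "0 \<noteq> x" using R(1) x_pos by (auto simp: x_def)
    qed
    also have "\<dots> \<le> K1 * R * 2"
    proof -
      have "\<omega> (norm x / R) \<le> 1 * (norm x / R) + 1 / real_of_int (\<rho> 0)" using \<omega>[of "norm x / R" 0] x_pos R by simp
      moreover have "norm x / R \<le> 1" using R by simp
      moreover have "1 / real_of_int (\<rho> 0) \<le> 1" using rho_pos by (simp add: divide_le_eq)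
      ultimately have "\<omega> (norm (x - 0) / R) \<le> 2" by simp
      then show ?thesis using K1 R by (intro mult_left_mono) auto
    qed
    also have "\<dots> \<le> K * R * 2" using K R by simp
    finally have "norm (f x - f 0) \<le> 6 * K / a * r" by (simp add: R_def field_simps)
    moreover have "norm (f 0) * 1 \<le> norm (f 0) * r" using r by (intro mult_left_mono) auto
    moreover have "norm (f x) \<le> norm (f 0) + norm (f x - f 0)" by (metis norm_triangle_sub)
    ultimately show ?thesis by (simp add: F_def x_def C_def algebra_simps)
  qed
  have lip: "norm (F z - F z') \<le> m\<^sup>2 * norm (G z - G z')" if z: "z \<in> int_box (n k)" "z' \<in> int_box (n k)" for z z'
  proof (cases "z = z'")
    case False
    define s where "s = norm (G z - G z')"
    have ne: "sh z \<noteq> sh z'" using False sh_inj by (auto simp: inj_def)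
    have s: "s \<ge> 2 / 3" using emb_separated[OF ne] by (simp add: s_def G_diff)
    have "s < a1 * (2 * r)"
    proof -
      have "s < a * r" using diam[OF z] DN rm by (simp add: s_def)
      also have "\<dots> \<le> a1 * r" using a r by (intro mult_right_mono) auto
      also have "\<dots> \<le> a1 * (2 * r)" using K1 r by simp
      finally show ?thesis .
    qed
    then have "norm (F z - F z') \<le> K1 * (2 * r) * \<omega> (s / (2 * r))"
      unfolding F_def s_def G_diff using nx[OF z(1)] nx[OF z(2)] r ne inj_emb
      by (intro f1) (auto simp: inj_def)
    also have "\<dots> \<le> K * (m * s + 2 * r / r)" using K K1 r s by (intro \<omega>k) auto
    also have "\<dots> = K * (m * s + 2)" using r by simp
    also have "\<dots> \<le> K * ((m + 2 * C + 3) * s)"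
    proof (rule mult_left_mono)
      have "2 \<le> 3 * s" "0 \<le> 2 * C * s" using s C by auto
      then show "m * s + 2 \<le> (m + 2 * C + 3) * s" by (simp add: algebra_simps)
    qed (use K in simp)
    also have "\<dots> \<le> m\<^sup>2 * s" using mult_right_mono[OF m2, of s] s by (simp add: mult.assoc)
    finally show ?thesis by (simp add: s_def)
  qed simp
  have colip: "norm (G z - G z') \<le> m\<^sup>2 * norm (F z - F z')"
    if z: "z \<in> int_box (n k)" and close: "norm (F z - F z') \<le> m\<^sup>2 * ?D * N" for z z'
  proof (cases "z = z'")
    case False
    define s where "s = norm (F z - F z')"
    have Fne: "F z \<noteq> F z'" using False bij_F by (auto simp: bij_betw_def inj_def)
    have s: "s \<ge> 1"
    proof -
      obtain p q where pq: "F z = lattice_point p" "F z' = lattice_point q"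
        using F_lat[of z] F_lat[of z'] unfolding range_lattice_point[symmetric] by auto
      then obtain i where "p i \<noteq> q i" using Fne by (auto simp: vec_eq_iff)
      then have "\<bar>real_of_int (p i) - real_of_int (q i)\<bar> \<ge> 1" by linarith
      then show ?thesis using component_le_norm_cart[of "F z - F z'" i] pq by (simp add: s_def)
    qed
    define R where "R = 2 * C * r"
    have Cr: "C * r \<ge> r" using C r by simp
    have R_eq: "R = 2 * (C * r)" by (simp add: R_def)
    then have R: "R > 0" "r \<le> R" "norm (F z) \<le> R" using nF[OF z] Cr r by linarith+
    have s_le: "s \<le> r / m" using close sp by (simp add: s_def)
    have "norm (F z') \<le> norm (F z) + norm (F z - F z')"
      by (metis norm_minus_commute norm_triangle_sub)
    then have R': "norm (F z') \<le> R"
      using nF[OF z] s_le rm Cr R_eq unfolding s_def by linarith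
    have "s < a2 * R"
    proof -
      have "s < a * r" using s_le rm by simp
      also have "\<dots> \<le> a2 * R" using a R r by (intro mult_mono) auto
      finally show ?thesis .
    qed
    then have "norm (G z - G z') \<le> K2 * R * \<omega> (s / R)"
      using f2[OF R(1) F_lat[of z'] F_lat[of z] R' R(3)] Fne by (simp add: s_def G_diff inv_F)
    also have "\<dots> \<le> K * (m * s + R / r)" using K K2 R s by (intro \<omega>k) auto
    also have "\<dots> = K * (m * s + 2 * C)" using r by (simp add: R_def)
    also have "\<dots> \<le> K * ((m + 2 * C + 3) * s)"
    proof (rule mult_left_mono)
      have "2 * C * 1 \<le> 2 * C * s" "0 \<le> 3 * s" using s C by (auto intro!: mult_left_mono)
      then show "m * s + 2 * C \<le> (m + 2 * C + 3) * s" by (simp add: algebra_simps)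
    qed (use K in simp)
    also have "\<dots> \<le> m\<^sup>2 * s" using mult_right_mono[OF m2, of s] s by (simp add: mult.assoc)
    finally show ?thesis by (simp add: s_def)
  qed simp
  show False
    using irr[of k] G_patch G_box bij_F lip colip
    unfolding irregular_patch_def m_def N_def by blast
qed

end

section \<open>Separating moduli of continuity\<close>

text \<open>If \<open>\<omega> t / t\<close> tends to infinity at \<open>0\<close>, then the patches can be placed so far away that the lattice with
  these patches is \<open>\<omega>\<close>-regular. The positions \<open>\<rho>\<close> then determine which slower moduli are excluded.\<close>
lemma separating_net:
  fixes \<omega> :: "real \<Rightarrow> real"
  assumes d: "CARD('n::finite) \<ge> 2"
    and mono: "strict_mono_on {0<..} \<omega>"
    and ratio: "\<And>t t'. 0 < t' \<Longrightarrow> t' \<le> t \<Longrightarrow> \<omega> t * t' \<le> \<omega> t' * t"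
    and ge: "\<And>t. 0 < t \<Longrightarrow> t \<le> 1 \<Longrightarrow> t \<le> \<omega> t"
    and growth: "\<And>N :: real. \<exists>T :: real. \<forall>r\<ge>T. r > 0 \<longrightarrow> N \<le> r * \<omega> ((2 / 3) / r)"
  obtains X :: "(real ^ 'n) set" and \<rho> :: "nat \<Rightarrow> int"
  where "\<And>k. int k < \<rho> k" "\<And>k k'. k \<le> k' \<Longrightarrow> \<rho> k \<le> \<rho> k'" "regular_separated_net {0<..} \<omega> X"
    "\<And>\<omega>'. (\<And>t k. t > 0 \<Longrightarrow> \<omega>' t \<le> (real k + 1) * t + 1 / real_of_int (\<rho> k)) \<Longrightarrow>
       \<not> regular_separated_net {0<..} \<omega>' X"
proof -
  \<comment> \<open>An arbitrary axis.\<close>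
  define i0 :: 'n where "i0 = undefined"
  have "\<forall>k :: nat. \<exists>n W. irregular_patch i0 ((real k + 1)\<^sup>2) n W"
    using d by (intro allI irregular_patch_exists) (auto simp: one_le_power)
  then obtain n W where nW: "\<And>k :: nat. irregular_patch i0 ((real k + 1)\<^sup>2) (n k) (W k)" by metis
  have "\<forall>k. \<exists>T. \<forall>r\<ge>T. r > 0 \<longrightarrow> real_of_int (n k) \<le> r * \<omega> ((2 / 3) / r)"
    using growth by blast
  then obtain T where T: "\<And>k :: nat. \<forall>r\<ge>T k. r > 0 \<longrightarrow> real_of_int (n k) \<le> r * \<omega> ((2 / 3) / r)"
    by metis
  define c where "c k = real CARD('n) * real_of_int (n k) * (real k + 1) ^ 3" for k
  define q where "q k = max 0 \<lceil>T k\<rceil> + max 0 \<lceil>c k\<rceil> + n k + 1" for k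
  \<comment> \<open>Consecutive positions differ by \<open>q k + q (Suc k)\<close>, which exceeds the side of the \<open>k\<close>-th patch.\<close>
  define \<rho> where "\<rho> k = q k + (\<Sum>j<k. 2 * q j)" for k
  have n_pos: "n k > 0" for k using nW[of k] by (simp add: irregular_patch_def)
  have q: "q k \<ge> \<lceil>T k\<rceil>" "q k \<ge> \<lceil>c k\<rceil>" "q k > n k" "q k > 0" for k
    using n_pos[of k] by (auto simp: q_def)
  have rho_q: "\<rho> k \<ge> q k" for k unfolding \<rho>_def using q(4) by (simp add: sum_nonneg less_imp_le)
  have rho_Suc: "\<rho> (Suc k) = \<rho> k + q k + q (Suc k)" for k by (simp add: \<rho>_def)
  interpret patched_lattice i0 n \<rho> W
  proof
    fix k z t
    show "0 < n k" by (rule n_pos)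
    show "0 < W k z" "2 * W k z dvd n k" "W k (z(i0 := t)) = W k z"
      using nW[of k] by (simp_all add: irregular_patch_def)
    show "0 < \<rho> 0" using rho_q[of 0] q(4)[of 0] by linarith
    show "\<rho> k + n k < \<rho> (Suc k)" using rho_Suc[of k] q(3)[of k] q(4)[of "Suc k"] by linarith
  qed
  show ?thesis
  proof (rule that[of \<rho> "range emb"])
    show "int k < \<rho> k" for k
    proof (induction k)
      case 0
      then show ?case using rho_pos by simp
    next
      case (Suc k)
      then show ?case using rho_Suc[of k] q(4)[of k] q(4)[of "Suc k"] by simp
    qed
    show "\<rho> k \<le> \<rho> k'" if "k \<le> k'" for k k'
      using that
    proof (induction k' rule: dec_induct)
      case (step k')
      then show ?case using rho_Suc[of k'] q(4)[of k'] q(4)[of "Suc k'"] by linarith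
    qed simp
    show "regular_separated_net {0<..} \<omega> (range emb)"
    proof (rule regular_range_emb[OF mono ratio ge])
      fix k
      have "T k \<le> real_of_int (\<rho> k)" using q(1)[of k] rho_q[of k] by (simp add: ceiling_le_iff[symmetric])
      then show "real_of_int (n k) \<le> real_of_int (\<rho> k) * \<omega> ((2 / 3) / real_of_int (\<rho> k))"
        using T[of k] rho_ge[of k] by simp
    qed
    show "\<not> regular_separated_net {0<..} \<omega>' (range emb)"
      if "\<And>t k. t > 0 \<Longrightarrow> \<omega>' t \<le> (real k + 1) * t + 1 / real_of_int (\<rho> k)" for \<omega>'
    proof (rule irregular_range_emb[OF nW _ that])
      fix k
      show "real CARD('n) * real_of_int (n k) * (real k + 1) ^ 3 \<le> real_of_int (\<rho> k)"
        using q(2)[of k] rho_q[of k] unfolding c_def[symmetric] by (simp add: ceiling_le_iff[symmetric])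
    qed
  qed
qed

text \<open>The largest function that satisfies all the bounds which exclude the net with patches at \<open>\<rho>\<close>. As an
  infimum of affine functions it is concave. Its quotient by the identity still tends to infinity at \<open>0\<close>:
  all but finitely many of the affine functions have a large slope, the others have positive values at \<open>0\<close>.\<close>
definition inf_modulus :: "(nat \<Rightarrow> int) \<Rightarrow> real \<Rightarrow> real" where
  "inf_modulus \<rho> t = (INF k. (real k + 1) * t + 1 / real_of_int (\<rho> k))"

locale growing_scales =
  fixes \<rho> :: "nat \<Rightarrow> int"
  assumes rho_gt: "int k < \<rho> k" and rho_mono: "k \<le> k' \<Longrightarrow> \<rho> k \<le> \<rho> k'"
begin

abbreviation "\<omega> \<equiv> inf_modulus \<rho>"

lemma rho_real: "real_of_int (\<rho> k) > 0" "real k + 1 \<le> real_of_int (\<rho> k)"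
  using rho_gt[of k] by linarith+

lemma modulus_le: "t > 0 \<Longrightarrow> \<omega> t \<le> (real k + 1) * t + 1 / real_of_int (\<rho> k)"
  unfolding inf_modulus_def
proof (rule cINF_lower)
  assume "t > 0"
  then show "bdd_below (range (\<lambda>k. (real k + 1) * t + 1 / real_of_int (\<rho> k)))"
    using rho_real by (intro bdd_belowI2[of _ 0]) (auto intro!: add_nonneg_nonneg simp: less_imp_le)
qed simp

lemma modulus_ge: "(\<And>k. x \<le> (real k + 1) * t + 1 / real_of_int (\<rho> k)) \<Longrightarrow> x \<le> \<omega> t"
  unfolding inf_modulus_def by (rule cINF_greatest) auto

lemma modulus_ge_id: "t > 0 \<Longrightarrow> t \<le> \<omega> t"
proof (rule modulus_ge)
  fix k assume "t > 0"
  then have "0 \<le> real k * t" by simp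
  moreover have "0 \<le> 1 / real_of_int (\<rho> k)" using rho_real(1)[of k] by simp
  ultimately show "t \<le> (real k + 1) * t + 1 / real_of_int (\<rho> k)" by (simp add: algebra_simps)
qed

lemma modulus_strict_mono: "strict_mono_on {0<..} \<omega>"
proof (rule strict_mono_onI)
  fix x y :: real assume xy: "x \<in> {0<..}" "y \<in> {0<..}" "x < y"
  have "\<omega> x + (y - x) \<le> \<omega> y"
  proof (rule modulus_ge)
    fix k
    have "0 \<le> real k * (y - x)" using xy by simp
    then show "\<omega> x + (y - x) \<le> (real k + 1) * y + 1 / real_of_int (\<rho> k)"
      using modulus_le[of x k] xy by (simp add: algebra_simps)
  qed
  then show "\<omega> x < \<omega> y" using xy by simp
qed

lemma modulus_concave: "concave_on {0<..} \<omega>"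
  unfolding concave_on_iff
proof (intro conjI ballI allI impI)
  fix x y u v :: real
  assume x: "x \<in> {0<..}" and y: "y \<in> {0<..}" and uv: "0 \<le> u" "0 \<le> v" "u + v = 1"
  show "u * \<omega> x + v * \<omega> y \<le> \<omega> (u *\<^sub>R x + v *\<^sub>R y)"
  proof (rule modulus_ge)
    fix k
    define e where "e = 1 / real_of_int (\<rho> k)"
    have "u * \<omega> x + v * \<omega> y \<le> u * ((real k + 1) * x + e) + v * ((real k + 1) * y + e)"
      using modulus_le[of x k] modulus_le[of y k] x y uv unfolding e_def by (intro add_mono mult_left_mono) auto
    also have "\<dots> = (real k + 1) * (u *\<^sub>R x + v *\<^sub>R y) + (u + v) * e" by (simp add: algebra_simps)
    finally show "u * \<omega> x + v * \<omega> y \<le> (real k + 1) * (u *\<^sub>R x + v *\<^sub>R y) + 1 / real_of_int (\<rho> k)"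
      using uv by (simp add: e_def)
  qed
qed simp

lemma modulus_tendsto: "(\<omega> \<longlongrightarrow> 0) (at_right 0)"
proof (rule tendstoI)
  fix e :: real assume e: "e > 0"
  obtain k :: nat where k: "2 / e < real k" using reals_Archimedean2 by blast
  have small: "1 / real_of_int (\<rho> k) < e / 2"
  proof -
    have "2 / e < real_of_int (\<rho> k)" using k rho_real(2)[of k] by linarith
    then show ?thesis using e rho_real(1)[of k] by (simp add: field_simps)
  qed
  have "dist (\<omega> t) 0 < e" if "0 < t" "t < e / (2 * (real k + 1))" for t
  proof -
    have "(real k + 1) * t < e / 2" using that(2) by (simp add: field_simps)
    then have "\<omega> t < e" using small modulus_le[OF that(1), of k] by linarith
    then show ?thesis using modulus_ge_id[OF that(1)] that(1) by (simp add: dist_real_def)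
  qed
  then show "\<forall>\<^sub>F t in at_right 0. dist (\<omega> t) 0 < e"
    unfolding eventually_at_right_field using e
    by (intro exI[of _ "e / (2 * (real k + 1))"]) auto
qed

lemma modulus_ratio:
  assumes "0 < t'" "t' \<le> t"
  shows "\<omega> t * t' \<le> \<omega> t' * t"
proof -
  have "\<omega> t * t' / t \<le> \<omega> t'"
  proof (rule modulus_ge)
    fix k
    let ?e = "1 / real_of_int (\<rho> k)"
    have "\<omega> t * t' \<le> ((real k + 1) * t + ?e) * t'" using modulus_le[of t k] assms by (intro mult_right_mono) auto
    also have "\<dots> = (real k + 1) * t' * t + ?e * t'" by (simp add: algebra_simps)
    also have "\<dots> \<le> (real k + 1) * t' * t + ?e * t"
      using assms rho_real(1)[of k] by (intro add_left_mono mult_left_mono) auto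
    finally have "\<omega> t * t' \<le> ((real k + 1) * t' + ?e) * t" by (simp add: algebra_simps)
    then show "\<omega> t * t' / t \<le> (real k + 1) * t' + ?e" using assms by (subst pos_divide_le_eq) auto
  qed
  then show ?thesis using assms by (subst (asm) pos_divide_le_eq) auto
qed

lemma modulus_growth: "\<exists>T :: real. \<forall>r\<ge>T. r > 0 \<longrightarrow> N \<le> r * \<omega> ((2 / 3) / r)"
proof -
  obtain m :: nat where m: "2 * \<bar>N\<bar> < real m" using reals_Archimedean2 by blast
  have "N \<le> r * \<omega> ((2 / 3) / r)" if r: "r \<ge> real m * real_of_int (\<rho> m)" "r > 0" for r
  proof -
    have "N / r \<le> \<omega> ((2 / 3) / r)"
    proof (rule modulus_ge)
      fix k
      let ?e = "1 / real_of_int (\<rho> k)"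
      have "N \<le> (real k + 1) * (2 / 3) + r * ?e"
      proof (cases "m \<le> k")
        case True
        then have "real m \<le> real k" by simp
        moreover have "r * ?e \<ge> 0" using r rho_real(1)[of k] by simp
        moreover have "N \<le> \<bar>N\<bar>" "0 \<le> \<bar>N\<bar>" by auto
        ultimately show ?thesis using m by argo
      next
        case False
        then have "real_of_int (\<rho> k) \<le> real_of_int (\<rho> m)" using rho_mono[of k m] by simp
        then have "real m * real_of_int (\<rho> k) \<le> real m * real_of_int (\<rho> m)" by (intro mult_left_mono) auto
        then have "real m * real_of_int (\<rho> k) \<le> r" using r by linarith
        then have "real m \<le> r * ?e" using rho_real(1)[of k] by (simp add: pos_le_divide_eq)
        moreover have "(real k + 1) * (2 / 3) \<ge> 0" by simp
        ultimately show ?thesis using m by linarith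
      qed
      then have "N / r \<le> ((real k + 1) * (2 / 3) + r * ?e) / r" using r by (intro divide_right_mono) auto
      also have "\<dots> = (real k + 1) * ((2 / 3) / r) + ?e" using r by (simp add: add_divide_distrib)
      finally show "N / r \<le> (real k + 1) * ((2 / 3) / r) + ?e" .
    qed
    then show ?thesis using r by (simp add: pos_divide_le_eq mult.commute)
  qed
  then show ?thesis by blast
qed

text \<open>For given \<open>t\<close> the bound with \<open>k\<close> about \<open>1 / sqrt t\<close> suffices, since \<open>\<rho> k \<ge> k + 1\<close>.\<close>

lemma modulus_le_sqrt:
  assumes "0 < t" "t < 1"
  shows "\<omega> t \<le> 3 * sqrt t"
proof -
  define c where "c = sqrt t"
  have c: "c > 0" "c * c = t" "c < 1" using assms by (auto simp: c_def)
  define k where "k = nat \<lfloor>1 / c\<rfloor>"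
  have "1 / c \<ge> 0" using c by simp
  then have k: "real k \<le> 1 / c" "1 / c < real k + 1" unfolding k_def by linarith+
  have "real k * c \<le> 1" using k(1) c by (simp add: field_simps)
  then have "(real k * c) * c \<le> 1 * c" using c by (intro mult_right_mono) auto
  then have "real k * t \<le> c" using c by (simp add: mult.assoc)
  moreover have "c * c \<le> 1 * c" using c by (intro mult_right_mono) auto
  then have "t \<le> c" using c by simp
  moreover have "1 / real_of_int (\<rho> k) \<le> c"
  proof -
    have "1 / c \<le> real_of_int (\<rho> k)" using k(2) rho_real(2)[of k] by linarith
    then show ?thesis using c rho_real(1)[of k] by (simp add: field_simps)
  qed
  ultimately show ?thesis using modulus_le[of t k] assms by (simp add: c_def algebra_simps)
qed

lemma modulus_of_continuity_inf: "modulus_of_continuity {0<..} \<omega>"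
  unfolding modulus_of_continuity_def
  using modulus_strict_mono modulus_concave modulus_tendsto by blast

end

section \<open>Three moduli of continuity\<close>
lemma concave_on_sqrt: "concave_on {0<..} sqrt"
  unfolding concave_on_iff
proof (intro conjI ballI allI impI)
  fix x y u v :: real
  assume x: "x \<in> {0<..}" and y: "y \<in> {0<..}" and uv: "0 \<le> u" "0 \<le> v" "u + v = 1"
  define a where "a = sqrt x"
  define b where "b = sqrt y"
  have ab: "x = a\<^sup>2" "y = b\<^sup>2" using x y by (auto simp: a_def b_def)
  have v: "v = 1 - u" using uv by simp
  have "u * a\<^sup>2 + v * b\<^sup>2 - (u * a + v * b)\<^sup>2 = u * v * (a - b)\<^sup>2"
    unfolding v by (simp add: algebra_simps power2_eq_square)
  moreover have "u * v * (a - b)\<^sup>2 \<ge> 0" using uv by simp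
  ultimately have "(u * a + v * b)\<^sup>2 \<le> u *\<^sub>R x + v *\<^sub>R y" unfolding ab by simp
  then show "u * sqrt x + v * sqrt y \<le> sqrt (u *\<^sub>R x + v *\<^sub>R y)"
    unfolding a_def[symmetric] b_def[symmetric] by (rule real_le_rsqrt)
qed simp

lemma modulus_of_continuity_sqrt: "modulus_of_continuity {0<..} sqrt"
proof -
  have "(sqrt \<longlongrightarrow> sqrt 0) (at_right 0)" by (intro tendsto_intros)
  then show ?thesis unfolding modulus_of_continuity_def
    using concave_on_sqrt by (auto simp: strict_mono_on_def)
qed

lemma modulus_of_continuity_id: "modulus_of_continuity {0<..} (\<lambda>t. t)"
proof -
  have "((\<lambda>t::real. t) \<longlongrightarrow> 0) (at_right 0)" by (rule tendsto_ident_at)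
  moreover have "concave_on {0<..} (\<lambda>t::real. t)" by (simp add: concave_on_iff)
  ultimately show ?thesis unfolding modulus_of_continuity_def by (auto simp: strict_mono_on_def)
qed

lemma sqrt_ratio:
  assumes "0 < t'" "t' \<le> t"
  shows "sqrt t * t' \<le> sqrt t' * t"
proof -
  have "sqrt t * t' = sqrt t * sqrt t' * sqrt t'" using assms by (simp add: mult.assoc)
  also have "\<dots> \<le> sqrt t * sqrt t' * sqrt t" using assms by (intro mult_left_mono) auto
  also have "\<dots> = sqrt t' * (sqrt t * sqrt t)" by (simp only: mult_ac)
  also have "\<dots> = sqrt t' * t" using assms by simp
  finally show ?thesis .
qed

lemma sqrt_growth: "\<exists>T :: real. \<forall>r\<ge>T. r > 0 \<longrightarrow> N \<le> r * sqrt ((2 / 3) / r)"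
proof (intro exI allI impI)
  fix r :: real assume r: "r \<ge> 2 * N\<^sup>2" "r > 0"
  have "N\<^sup>2 \<le> r\<^sup>2 * ((2 / 3) / r)" using r by (simp add: power2_eq_square)
  then have "N \<le> sqrt (r\<^sup>2 * ((2 / 3) / r))" by (rule real_le_rsqrt)
  also have "\<dots> = r * sqrt ((2 / 3) / r)" using r by (simp only: real_sqrt_mult real_sqrt_abs abs_of_pos)
  finally show "N \<le> r * sqrt ((2 / 3) / r)" .
qed

theorem corollary7p2:
  assumes "CARD('n::finite) \<ge> 2"
  shows "\<exists>(I :: nat \<Rightarrow> real set) (\<omega> :: nat \<Rightarrow> real \<Rightarrow> real).
    (\<forall>i\<in>{1,2,3}. modulus_of_continuity (I i) (\<omega> i)) \<and>
    (\<forall>i\<in>{1,2,3}. \<forall>j\<in>{1,2,3}. i < j \<longrightarrow>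
       {X :: (real ^ 'n) set. regular_separated_net (I j) (\<omega> j) X}
         \<subset> {X. regular_separated_net (I i) (\<omega> i) X})"
proof -
  let ?reg = "\<lambda>\<omega>. {X :: (real ^ 'n) set. regular_separated_net {0<..} \<omega> X}"
  have sqrt_ge: "t \<le> sqrt t" if "0 < t" "t \<le> 1" for t :: real
    using that by (intro real_le_rsqrt) (simp add: power2_eq_square mult_left_le)
  have sqrt_mono: "strict_mono_on {0<..} sqrt" by (auto simp: strict_mono_on_def)
  obtain X1 :: "(real ^ 'n) set" and \<rho> :: "nat \<Rightarrow> int"
    where rho: "\<And>k. int k < \<rho> k" "\<And>k k'. k \<le> k' \<Longrightarrow> \<rho> k \<le> \<rho> k'"
      and X1: "regular_separated_net {0<..} sqrt X1"
        "\<And>\<omega>'. (\<And>t k. t > 0 \<Longrightarrow> \<omega>' t \<le> (real k + 1) * t + 1 / real_of_int (\<rho> k)) \<Longrightarrow>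
           \<not> regular_separated_net {0<..} \<omega>' X1"
    using separating_net[OF assms sqrt_mono sqrt_ratio sqrt_ge sqrt_growth] by metis
  interpret growing_scales \<rho> using rho by unfold_locales
  obtain X2 :: "(real ^ 'n) set" and \<rho>' :: "nat \<Rightarrow> int"
    where rho': "\<And>k. int k < \<rho>' k"
      and X2: "regular_separated_net {0<..} \<omega> X2"
        "\<And>\<omega>'. (\<And>t k. t > 0 \<Longrightarrow> \<omega>' t \<le> (real k + 1) * t + 1 / real_of_int (\<rho>' k)) \<Longrightarrow>
           \<not> regular_separated_net {0<..} \<omega>' X2"
    using separating_net[OF assms modulus_strict_mono modulus_ratio modulus_ge_id modulus_growth] by metis
  have id_le: "t \<le> (real k + 1) * t + 1 / real_of_int (\<rho>' k)" if "t > 0" for t k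
  proof -
    have "0 \<le> real k * t" "0 \<le> 1 / real_of_int (\<rho>' k)" using that rho'[of k] by auto
    then show ?thesis by (simp add: algebra_simps)
  qed
  have "?reg \<omega> \<subseteq> ?reg sqrt"
    using regular_separated_net_weaken[of \<omega> _ 3 sqrt] modulus_le_sqrt by auto
  then have 12: "?reg \<omega> \<subset> ?reg sqrt" using X1(1) X1(2)[OF modulus_le] by blast
  have "?reg (\<lambda>t. t) \<subseteq> ?reg \<omega>"
    using regular_separated_net_weaken[of "\<lambda>t. t" _ 1 \<omega>] modulus_ge_id by auto
  then have 23: "?reg (\<lambda>t. t) \<subset> ?reg \<omega>" using X2(1) X2(2)[OF id_le] by blast
  define \<omega>s :: "nat \<Rightarrow> real \<Rightarrow> real" where "\<omega>s i = (if i = 1 then sqrt else if i = 2 then \<omega> else (\<lambda>t. t))" for i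
  have \<omega>s: "\<omega>s 1 = sqrt" "\<omega>s 2 = \<omega>" "\<omega>s 3 = (\<lambda>t. t)" by (simp_all add: \<omega>s_def)
  show ?thesis
  proof (intro exI[of _ "\<lambda>_. {0<..}"] exI[of _ \<omega>s] conjI ballI impI)
    fix i :: nat assume "i \<in> {1, 2, 3}"
    then show "modulus_of_continuity {0<..} (\<omega>s i)"
      using modulus_of_continuity_sqrt modulus_of_continuity_inf modulus_of_continuity_id \<omega>s by auto
  next
    fix i j :: nat assume "i \<in> {1, 2, 3}" "j \<in> {1, 2, 3}" "i < j"
    then have "i = 1 \<and> j = 2 \<or> i = 1 \<and> j = 3 \<or> i = 2 \<and> j = 3" by auto
    then show "?reg (\<omega>s j) \<subset> ?reg (\<omega>s i)"
      using 12 23 psubset_trans[OF 23 12] by (elim disjE conjE; simp only: \<omega>s)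
  qed
qed

end
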